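(* Let $\alpha=\sqrt{F(x_0)(1-F(x_0))/g(x_0)}>0$ and $\beta=f(x_0)/2>0$, and for $c>0$ let $\mathcal S_c=\mathbb X_{c,\alpha,\beta}(0)$. Then, as $c\to0$, $$\mathcal S_c\ \xrightarrow{d}\ g_{\alpha,\beta}(0)\ \stackrel{d}{=}\ 2(\alpha^2\beta)^{1/3}\,\mathcal Z,$$ where $\mathcal Z$ has Chernoff's distribution, i.e. the distribution of the (a.s. unique) minimizer over $t\in\mathbb R$ of $W(t)+t^2$ with $W$ a standard two-sided Brownian motion.
   Context: $F$ is a distribution function with density $f$, $g$ is a density, and $x_0$ is a fixed point with $0<F(x_0)<1$, $f(x_0)>0$, $g(x_0)>0$; these enter only through the positive constants $\alpha$ and $\beta$. Let $W$ be a standard two-sided Brownian motion with $W(0)=0$. For $c,\kappa_1,\kappa_2>0$ let $\mathcal P_{c,\kappa_1,\kappa_2}(k)=\big(ck,\ \kappa_1W(ck)+\kappa_2c^2k(1+k)\big)\in\mathbb R^2$, $k\in\mathbb Z$. $\mathbb X_{c,\kappa_1,\kappa_2}(0)$ is the left derivative at $0$ of the greatest convex minorant (a piecewise linear convex function on $\mathbb R$) of the point set $\{\mathcal P_{c,\kappa_1,\kappa_2}(k):k\in\mathbb Z\}$. For $\kappa_1,\kappa_2>0$, $X_{\kappa_1,\kappa_2}(h)=\kappa_1W(h)+\kappa_2h^2$, $h\in\mathbb R$, and $g_{\kappa_1,\kappa_2}(h)$ is the left derivative at $h$ of the greatest convex minorant of $X_{\kappa_1,\kappa_2}$ on $\mathbb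 R$. *)

theory Defs
  imports "HOL-Probability.Probability"
begin

text \<open>
  Standard two-sided Brownian motion, normalised at the origin. As usual, all sample paths are
  continuous, so that path functionals need no completion of the underlying measure.
\<close>

locale two_sided_brownian_motion = prob_space M for M :: "'a measure" +
  fixes W :: "real \<Rightarrow> 'a \<Rightarrow> real"
  assumes measurable_W: "\<And>t. W t \<in> borel_measurable M"
    and W_zero: "\<And>\<omega>. \<omega> \<in> space M \<Longrightarrow> W 0 \<omega> = 0"
    and continuous_paths: "\<And>\<omega>. \<omega> \<in> space M \<Longrightarrow> continuous_on UNIV (\<lambda>t. W t \<omega>)"
    and normal_increments: "\<And>s t. s < t \<Longrightarrow>
      distributed M lborel (\<lambda>\<omega>. W t \<omega> - W s \<omega>) (normal_density 0 (sqrt (t - s)))"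
    and indep_increments: "\<And>(t :: nat \<Rightarrow> real) n. mono t \<Longrightarrow>
      indep_vars (\<lambda>_. borel) (\<lambda>i \<omega>. W (t (Suc i)) \<omega> - W (t i) \<omega>) {..<n}"

definition density_fun :: "(real \<Rightarrow> real) \<Rightarrow> bool" where
  "density_fun f \<longleftrightarrow> f \<in> borel_measurable borel \<and> (\<forall>x. 0 \<le> f x) \<and> prob_space (density lborel f)"

text \<open>
  The greatest convex minorant on the whole line of a set of points in the plane; the greatest
  convex minorant of a function is that of its graph. If there is no convex minorant at all (a
  null event for the point sets below), this is the supremum of the empty set, the same real number
  for every \<open>x\<close>. Otherwise the supremum is bounded above for the point sets below, since
  their abscissae are unbounded in both directions.
\<close>

definition gcm :: "(real \<times> real) set \<Rightarrow> real \<Rightarrow> real" where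
  "gcm P x = Sup {\<phi> x | \<phi>. convex_on UNIV \<phi> \<and> (\<forall>(u, v)\<in>P. \<phi> u \<le> v)}"

definition left_deriv :: "(real \<Rightarrow> real) \<Rightarrow> real \<Rightarrow> real" where
  "left_deriv \<phi> x = (THE D. (\<phi> has_real_derivative D) (at_left x))"

text \<open>In the following, \<open>w\<close> is a single path, later a sample path of a Brownian motion.\<close>

definition grid_point :: "real \<Rightarrow> real \<Rightarrow> real \<Rightarrow> (real \<Rightarrow> real) \<Rightarrow> int \<Rightarrow> real \<times> real" where
  "grid_point c \<kappa>\<^sub>1 \<kappa>\<^sub>2 w k =
     (c * of_int k, \<kappa>\<^sub>1 * w (c * of_int k) + \<kappa>\<^sub>2 * c\<^sup>2 * of_int k * (1 + of_int k))"

definition grid_slope_zero :: "real \<Rightarrow> real \<Rightarrow> real \<Rightarrow> (real \<Rightarrow> real) \<Rightarrow> real" where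
  "grid_slope_zero c \<kappa>\<^sub>1 \<kappa>\<^sub>2 w = left_deriv (gcm (range (grid_point c \<kappa>\<^sub>1 \<kappa>\<^sub>2 w))) 0"

definition drift_process :: "real \<Rightarrow> real \<Rightarrow> (real \<Rightarrow> real) \<Rightarrow> real \<Rightarrow> real" where
  "drift_process \<kappa>\<^sub>1 \<kappa>\<^sub>2 w h = \<kappa>\<^sub>1 * w h + \<kappa>\<^sub>2 * h\<^sup>2"

definition slope_process :: "real \<Rightarrow> real \<Rightarrow> (real \<Rightarrow> real) \<Rightarrow> real \<Rightarrow> real" where
  "slope_process \<kappa>\<^sub>1 \<kappa>\<^sub>2 w h = left_deriv (gcm (range (\<lambda>t. (t, drift_process \<kappa>\<^sub>1 \<kappa>\<^sub>2 w t)))) h"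

definition is_chernoff_minimizer :: "(real \<Rightarrow> real) \<Rightarrow> real \<Rightarrow> bool" where
  "is_chernoff_minimizer w = is_arg_min (\<lambda>t. w t + t\<^sup>2) (\<lambda>_. True)"

text \<open>
  The value \<open>0\<close> is used when there is no unique minimizer (a null event for Brownian paths); an
  arbitrary choice among several minimizers need not be measurable.
\<close>

definition chernoff_minimizer :: "(real \<Rightarrow> real) \<Rightarrow> real" where
  "chernoff_minimizer w =
     (if \<exists>!t. is_chernoff_minimizer w t then THE t. is_chernoff_minimizer w t else 0)"

end

theory Submission
  imports Defs
begin

text \<open>
  Everything is read off from minimizers. If \<open>X t - a t\<close>, \<open>X t = \<alpha> W t + \<beta> t\<^sup>2\<close>, has a unique
  minimizer \<open>T\<close>, then the left slope at \<open>0\<close> of the greatest convex minorant of \<open>X\<close> is at most \<open>a\<close>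
  iff \<open>T \<ge> 0\<close>; and if \<open>T \<noteq> 0\<close>, a line below \<open>X\<close> that separates the minorant from the chord of slope
  \<open>a\<close> through \<open>(T, X T)\<close> shows that the slope of the grid minorant is eventually on the same side of
  \<open>a\<close>. Completing the square, \<open>T\<close> is an affine image of the Chernoff minimizer of another Brownian
  motion, and the law of that minimizer depends only on the finite-dimensional distributions. This
  identifies the distribution function of the slope and shows that \<open>T \<noteq> 0\<close> almost surely at its
  continuity points, so dominated convergence of the events \<open>slope \<le> a\<close> yields the weak limit.

  Two properties of Brownian paths are needed: quadratic growth, obtained by dyadic chaining with
  fourth moments, and uniqueness of the minimizer, obtained from Fubini's theorem.
\<close>

section \<open>Greatest convex minorants of planar point sets\<close>

text \<open>The slopes for all grid widths and the limiting slope are functionals of the same path,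
  so for fixed \<open>a\<close> the events \<open>slope \<le> a\<close> are compared path by path;
  only the law of the minimizer has to be moved between probability spaces. The case T = 0 is set
  aside because the line of slope \<open>a\<close> then touches the path at the origin, and a small
  perturbation may push the grid slope to either side of \<open>a\<close>. Measurability shapes much
  of the rest. The law of a path lives on the product sigma-algebra, whose events see only countably
  many coordinates, whereas a greatest convex minorant is a supremum over an uncountable family and
  a minimizer ranges over all times. Hence the dual description of the minorant as an infimum of
  chords, a countable one over the grid and over \<open>\<rat>\<close>, and the description of
  minimizers by near-minimizers at rational times. Both must also account for the default values on
  exceptional paths.\<close>

definition two_sided_unbounded :: "real set \<Rightarrow> bool" where
  "two_sided_unbounded D \<longleftrightarrow> (\<forall>x. (\<exists>p\<in>D. p < x) \<and> (\<exists>q\<in>D. x < q))"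

definition graph_on :: "real set \<Rightarrow> (real \<Rightarrow> real) \<Rightarrow> (real \<times> real) set" where
  "graph_on D X = (\<lambda>u. (u, X u)) ` D"

definition convex_minorant :: "(real \<times> real) set \<Rightarrow> (real \<Rightarrow> real) \<Rightarrow> bool" where
  "convex_minorant P \<phi> \<longleftrightarrow> convex_on UNIV \<phi> \<and> (\<forall>(u, v)\<in>P. \<phi> u \<le> v)"

text \<open>The height at \<open>x\<close> of the line through \<open>(p, X p)\<close> and
  \<open>(q, X q)\<close>. It is used for \<open>p \<le> x < q\<close>: the denominator stays
  positive, and \<open>p = x\<close> gives \<open>X x\<close>, so that a point of the set over
  \<open>x\<close> itself counts as a chord.\<close>

definition chord :: "(real \<Rightarrow> real) \<Rightarrow> real \<Rightarrow> real \<Rightarrow> real \<Rightarrow> real" where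
  "chord X p q x = ((q - x) * X p + (x - p) * X q) / (q - p)"

lemma gcm_eq: "gcm P x = (SUP \<phi>\<in>{\<phi>. convex_minorant P \<phi>}. \<phi> x)"
  unfolding gcm_def convex_minorant_def by (rule arg_cong[where f = Sup]) auto

lemma convex_minorant_graph_on:
  "convex_minorant (graph_on D X) \<phi> \<longleftrightarrow> convex_on UNIV \<phi> \<and> (\<forall>u\<in>D. \<phi> u \<le> X u)"
  by (auto simp: convex_minorant_def graph_on_def)

lemma convex_on_affine: "convex_on UNIV (\<lambda>u::real. b + s * u)"
  by (simp add: convex_on_alt algebra_simps)

lemma convex_on_le_chord:
  assumes "convex_on UNIV \<phi>" "p \<le> x" "x < q"
  shows "\<phi> x \<le> chord \<phi> p q x"
proof -
  define t where "t = (x - p) / (q - p)"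
  have t: "0 \<le> t" "t \<le> 1" using assms by (auto simp: t_def)
  have "(1 - t) *\<^sub>R p + t *\<^sub>R q = p + t * (q - p)" by (simp add: algebra_simps)
  also have "\<dots> = x" using assms by (simp add: t_def)
  finally have "\<phi> x \<le> (1 - t) * \<phi> p + t * \<phi> q"
    using convex_onD[OF assms(1) t, of p q] by simp
  also have "\<dots> = chord \<phi> p q x"
    using assms by (simp add: t_def chord_def divide_simps)
  finally show ?thesis .
qed

lemma chord_mono:
  assumes "\<phi> p \<le> X p" "\<phi> q \<le> X q" "p \<le> x" "x < q"
  shows "chord \<phi> p q x \<le> chord X p q x"
  unfolding chord_def using assms by (intro divide_right_mono add_mono mult_left_mono) auto

text \<open>The chord condition says that every slope from a point on the left to
  \<open>(x, r)\<close> is at most every slope from \<open>(x, r)\<close> to a point on the right.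
  Any number in between is the slope of a supporting line; the supremum of the left slopes is one,
  finite because both sides are nonempty.\<close>

lemma supporting_line_exists:
  assumes D: "two_sided_unbounded D"
    and r: "\<And>p q. p \<in> D \<Longrightarrow> q \<in> D \<Longrightarrow> p \<le> x \<Longrightarrow> x < q \<Longrightarrow> r \<le> chord X p q x"
  shows "\<exists>s. \<forall>u\<in>D. r + s * (u - x) \<le> X u"
proof -
  define L where "L = (\<lambda>p. (r - X p) / (x - p)) ` {p\<in>D. p < x}"
  obtain p0 q0 where p0: "p0 \<in> D" "p0 < x" and q0: "q0 \<in> D" "x < q0"
    using D unfolding two_sided_unbounded_def by meson
  have L_le: "l \<le> (X q - r) / (q - x)" if l: "l \<in> L" and q: "q \<in> D" "x < q" for l q
  proof -
    obtain p where p: "p \<in> D" "p < x" and l': "l = (r - X p) / (x - p)"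
      using l by (auto simp: L_def)
    have "r \<le> chord X p q x" using r[of p q] p q by simp
    then have "r * (q - p) \<le> (q - x) * X p + (x - p) * X q"
      using p q by (simp add: chord_def pos_le_divide_eq)
    then have "(r - X p) * (q - x) \<le> (X q - r) * (x - p)" by (simp add: algebra_simps)
    then show ?thesis using p q by (simp add: l' divide_simps mult.commute)
  qed
  have bdd: "bdd_above L" by (rule bdd_aboveI) (rule L_le[OF _ q0])
  have ne: "L \<noteq> {}" using p0 by (auto simp: L_def)
  have "r + Sup L * (u - x) \<le> X u" if u: "u \<in> D" for u
  proof (cases u x rule: linorder_cases)
    case less
    then have "(r - X u) / (x - u) \<le> Sup L"
      using u by (intro cSup_upper bdd) (auto simp: L_def)
    then show ?thesis using less by (simp add: pos_divide_le_eq algebra_simps)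
  next
    case equal
    have "r \<le> chord X u q0 x" using r[of u q0] u q0 equal by simp
    also have "\<dots> = X u" using q0 equal by (simp add: chord_def)
    finally show ?thesis using equal by simp
  next
    case greater
    then have "Sup L \<le> (X u - r) / (u - x)"
      using u ne by (intro cSup_least L_le)
    then show ?thesis using greater by (simp add: pos_le_divide_eq algebra_simps)
  qed
  then show ?thesis by blast
qed

lemma supporting_line_minorant:
  assumes "\<forall>u\<in>D. r + s * (u - x) \<le> X u"
  shows "convex_minorant (graph_on D X) (\<lambda>u. r + s * (u - x))"
  using assms convex_on_affine[of "r - s * x" s]
  by (simp add: convex_minorant_graph_on algebra_simps)

lemma convex_minorant_le_chord:
  assumes "convex_minorant (graph_on D X) \<phi>" "p \<in> D" "q \<in> D" "p \<le> x" "x < q"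
  shows "\<phi> x \<le> chord X p q x"
  using assms convex_on_le_chord[of \<phi> p x q] chord_mono[of \<phi> p X q x]
  by (force simp: convex_minorant_graph_on)

text \<open>For countable \<open>D\<close> the right side involves countably many values of
  \<open>X\<close>, so the default case of \<open>gcm\<close>, a supremum of the empty set, becomes
  a measurable event.\<close>

lemma ex_convex_minorant_iff:
  assumes D: "two_sided_unbounded D"
  shows "(\<exists>\<phi>. convex_minorant (graph_on D X) \<phi>) \<longleftrightarrow>
    (\<exists>n::nat. \<forall>p\<in>D. \<forall>q\<in>D. p \<le> x \<and> x < q \<longrightarrow> - real n \<le> chord X p q x)"
proof
  assume "\<exists>\<phi>. convex_minorant (graph_on D X) \<phi>"
  then obtain \<phi> where \<phi>: "convex_minorant (graph_on D X) \<phi>" by blast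
  obtain n :: nat where "- \<phi> x \<le> real n" using real_arch_simple by blast
  then have "- real n \<le> chord X p q x" if "p \<in> D" "q \<in> D" "p \<le> x" "x < q" for p q
    using convex_minorant_le_chord[OF \<phi> that] by linarith
  then show "\<exists>n::nat. \<forall>p\<in>D. \<forall>q\<in>D. p \<le> x \<and> x < q \<longrightarrow> - real n \<le> chord X p q x" by blast
next
  assume "\<exists>n::nat. \<forall>p\<in>D. \<forall>q\<in>D. p \<le> x \<and> x < q \<longrightarrow> - real n \<le> chord X p q x"
  then obtain n :: nat where
    "\<And>p q. p \<in> D \<Longrightarrow> q \<in> D \<Longrightarrow> p \<le> x \<Longrightarrow> x < q \<Longrightarrow> - real n \<le> chord X p q x" by blast
  from supporting_line_exists[OF D this] show "\<exists>\<phi>. convex_minorant (graph_on D X) \<phi>"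
    using supporting_line_minorant by blast
qed

lemma bdd_above_convex_minorants:
  assumes D: "two_sided_unbounded D"
  shows "bdd_above ((\<lambda>\<phi>. \<phi> x) ` {\<phi>. convex_minorant (graph_on D X) \<phi>})"
proof -
  obtain p q where "p \<in> D" "p < x" "q \<in> D" "x < q"
    using D unfolding two_sided_unbounded_def by meson
  then show ?thesis
    using convex_minorant_le_chord[of D X _ p q x] by (intro bdd_aboveI) auto
qed

lemma gcm_upper:
  assumes "two_sided_unbounded D" "convex_minorant (graph_on D X) \<phi>"
  shows "\<phi> x \<le> gcm (graph_on D X) x"
  unfolding gcm_eq using assms by (intro cSUP_upper bdd_above_convex_minorants) auto

lemma gcm_least:
  assumes "convex_minorant (graph_on D X) \<phi>"
    and "\<And>\<psi>. convex_minorant (graph_on D X) \<psi> \<Longrightarrow> \<psi> x \<le> r"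
  shows "gcm (graph_on D X) x \<le> r"
  unfolding gcm_eq using assms by (intro cSUP_least) auto

lemma convex_minorant_gcm:
  assumes D: "two_sided_unbounded D" and \<phi>: "convex_minorant (graph_on D X) \<phi>"
  shows "convex_minorant (graph_on D X) (gcm (graph_on D X))"
  unfolding convex_minorant_graph_on
proof (intro conjI ballI)
  show "convex_on UNIV (gcm (graph_on D X))"
  proof (intro convex_onI)
    fix t x y :: real assume t: "0 < t" "t < 1"
    show "gcm (graph_on D X) ((1 - t) *\<^sub>R x + t *\<^sub>R y)
      \<le> (1 - t) * gcm (graph_on D X) x + t * gcm (graph_on D X) y"
    proof (rule gcm_least[OF \<phi>])
      fix \<psi> assume \<psi>: "convex_minorant (graph_on D X) \<psi>"
      then have "\<psi> ((1 - t) *\<^sub>R x + t *\<^sub>R y) \<le> (1 - t) * \<psi> x + t * \<psi> y"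
        using t by (intro convex_onD) (auto simp: convex_minorant_graph_on)
      also have "\<dots> \<le> (1 - t) * gcm (graph_on D X) x + t * gcm (graph_on D X) y"
        using t gcm_upper[OF D \<psi>] by (intro add_mono mult_left_mono) auto
      finally show "\<psi> ((1 - t) *\<^sub>R x + t *\<^sub>R y)
        \<le> (1 - t) * gcm (graph_on D X) x + t * gcm (graph_on D X) y" .
    qed
  qed simp
next
  fix u assume "u \<in> D"
  then show "gcm (graph_on D X) u \<le> X u"
    by (intro gcm_least[OF \<phi>]) (auto simp: convex_minorant_graph_on)
qed

text \<open>Duality: the supremum of the minorants at \<open>x\<close> is the infimum of the chords
  over \<open>x\<close>. Convexity gives one inequality; for the other, the line from
  \<open>supporting_line_exists\<close> is itself a minorant with value \<open>r\<close> at
  \<open>x\<close>.\<close>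

lemma le_gcm_iff:
  assumes D: "two_sided_unbounded D" and \<phi>: "convex_minorant (graph_on D X) \<phi>"
  shows "r \<le> gcm (graph_on D X) x \<longleftrightarrow>
    (\<forall>p\<in>D. \<forall>q\<in>D. p \<le> x \<and> x < q \<longrightarrow> r \<le> chord X p q x)" (is "?L \<longleftrightarrow> ?R")
proof
  assume ?L
  then show ?R
    using convex_minorant_le_chord[OF convex_minorant_gcm[OF D \<phi>]] by (meson order_trans)
next
  assume ?R
  then have r: "\<And>p q. p \<in> D \<Longrightarrow> q \<in> D \<Longrightarrow> p \<le> x \<Longrightarrow> x < q \<Longrightarrow> r \<le> chord X p q x" by blast
  obtain s where s: "\<forall>u\<in>D. r + s * (u - x) \<le> X u"
    using supporting_line_exists[where X = X and x = x and r = r, OF D r] by blast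
  from gcm_upper[OF D supporting_line_minorant[OF s], of x] show ?L by simp
qed

text \<open>Convex functions on the line are continuous, so a minorant on \<open>\<rat>\<close> is one everywhere.\<close>

lemma gcm_graph_on_Rats:
  assumes X: "continuous_on UNIV X"
  shows "gcm (graph_on UNIV X) = gcm (graph_on \<rat> X)"
proof -
  have "convex_minorant (graph_on UNIV X) \<phi> \<longleftrightarrow> convex_minorant (graph_on \<rat> X) \<phi>" for \<phi>
  proof
    assume \<phi>: "convex_minorant (graph_on \<rat> X) \<phi>"
    then have "continuous_on UNIV \<phi>"
      by (intro convex_on_continuous) (simp_all add: convex_minorant_graph_on)
    then have "continuous_on UNIV (\<lambda>u. X u - \<phi> u)"
      by (intro continuous_on_diff X)
    then have "continuous_on (closure \<rat>) (\<lambda>u. X u - \<phi> u)"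
      by (rule continuous_on_subset) simp
    moreover have "0 \<le> X u - \<phi> u" if "u \<in> \<rat>" for u
      using \<phi> that by (simp add: convex_minorant_graph_on)
    ultimately have "0 \<le> X u - \<phi> u" for u
      using continuous_ge_on_closure[of \<rat> "\<lambda>u. X u - \<phi> u" u 0] by (simp add: Rats_closure_real)
    then show "convex_minorant (graph_on UNIV X) \<phi>"
      using \<phi> by (simp add: convex_minorant_graph_on)
  qed (simp add: convex_minorant_graph_on)
  then have "{\<phi>. convex_minorant (graph_on UNIV X) \<phi>} = {\<phi>. convex_minorant (graph_on \<rat> X) \<phi>}"
    by blast
  then show ?thesis unfolding gcm_eq fun_eq_iff by (simp only: simp_thms)
qed

section \<open>Left derivatives of convex functions\<close>

text \<open>The position \<open>y < x < z\<close> is included because it bounds the left quotients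
  by a right one, which keeps the left derivative finite.\<close>

lemma convex_on_slope_mono:
  fixes \<phi> :: "real \<Rightarrow> real"
  assumes \<phi>: "convex_on UNIV \<phi>" and "y \<le> z" "y \<noteq> x" "z \<noteq> x"
  shows "(\<phi> y - \<phi> x) / (y - x) \<le> (\<phi> z - \<phi> x) / (z - x)"
proof -
  have swap: "(\<phi> a - \<phi> b) / (a - b) = (\<phi> b - \<phi> a) / (b - a)" for a b
    using minus_divide_divide[of "\<phi> b - \<phi> a" "b - a"] by simp
  consider "y = z" | "y < z" "z < x" | "y < x" "x < z" | "x < y" "y < z"
    using assms(2-4) by (metis linorder_neqE order_le_imp_less_or_eq)
  then show ?thesis
  proof cases
    case 2
    then show ?thesis by (rule convex_on_slope_le(2)[OF \<phi> UNIV_I UNIV_I])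
  next
    case 3
    have "(\<phi> y - \<phi> x) / (y - x) \<le> (\<phi> y - \<phi> z) / (y - z)"
      by (rule convex_on_slope_le(1)[OF \<phi> UNIV_I UNIV_I 3])
    also have "\<dots> \<le> (\<phi> x - \<phi> z) / (x - z)"
      by (rule convex_on_slope_le(2)[OF \<phi> UNIV_I UNIV_I 3])
    also note swap[of x z]
    finally show ?thesis .
  next
    case 4
    have "(\<phi> x - \<phi> y) / (x - y) \<le> (\<phi> x - \<phi> z) / (x - z)"
      by (rule convex_on_slope_le(1)[OF \<phi> UNIV_I UNIV_I 4])
    then show ?thesis unfolding swap[of x z] swap[of x y] .
  qed simp
qed

lemma left_deriv_unique:
  assumes "(\<phi> has_real_derivative D) (at_left x)"
  shows "left_deriv \<phi> x = D"
  unfolding left_deriv_def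
proof (rule the_equality)
  fix E assume "(\<phi> has_real_derivative E) (at_left x)"
  with assms show "E = D"
    unfolding has_field_derivative_iff
    using tendsto_unique[OF trivial_limit_at_left_real] by blast
qed (rule assms)

lemma convex_on_has_left_derivative:
  fixes \<phi> :: "real \<Rightarrow> real"
  assumes \<phi>: "convex_on UNIV \<phi>"
  shows "(\<phi> has_real_derivative (SUP y\<in>{..<x}. (\<phi> y - \<phi> x) / (y - x))) (at_left x)"
proof -
  have "((\<lambda>y. (\<phi> y - \<phi> x) / (y - x)) \<longlongrightarrow>
      Sup ((\<lambda>y. (\<phi> y - \<phi> x) / (y - x)) ` ({..<x} \<inter> UNIV))) (at x within ({..<x} \<inter> UNIV))"
  proof (rule Lim_left_bound)
    fix a b assume "b < x" "a \<le> b"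
    then show "(\<phi> a - \<phi> x) / (a - x) \<le> (\<phi> b - \<phi> x) / (b - x)"
      by (intro convex_on_slope_mono[OF \<phi>]) auto
  next
    fix b assume "b < x"
    then show "(\<phi> b - \<phi> x) / (b - x) \<le> (\<phi> (x + 1) - \<phi> x) / (x + 1 - x)"
      by (intro convex_on_slope_mono[OF \<phi>]) auto
  qed
  then show ?thesis unfolding has_field_derivative_iff by simp
qed

lemma left_deriv_convex_on:
  "convex_on UNIV \<phi> \<Longrightarrow> left_deriv \<phi> x = (SUP y\<in>{..<x}. (\<phi> y - \<phi> x) / (y - x))"
  by (intro left_deriv_unique convex_on_has_left_derivative)

lemma le_left_deriv:
  assumes "convex_on UNIV \<phi>" "y < x"
  shows "(\<phi> y - \<phi> x) / (y - x) \<le> left_deriv \<phi> x"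
  unfolding left_deriv_convex_on[OF assms(1)]
  by (intro cSUP_upper bdd_aboveI2[where M = "(\<phi> (x + 1) - \<phi> x) / (x + 1 - x)"]
      convex_on_slope_mono) (use assms in auto)

lemma left_deriv_le_slope:
  assumes "convex_on UNIV \<phi>" "x < y"
  shows "left_deriv \<phi> x \<le> (\<phi> y - \<phi> x) / (y - x)"
  unfolding left_deriv_convex_on[OF assms(1)]
  by (intro cSUP_least convex_on_slope_mono) (use assms in auto)

lemma left_deriv_le:
  assumes "convex_on UNIV \<phi>" "\<And>y. y < x \<Longrightarrow> (\<phi> y - \<phi> x) / (y - x) \<le> a"
  shows "left_deriv \<phi> x \<le> a"
  unfolding left_deriv_convex_on[OF assms(1)]
  by (intro cSUP_least assms(2)) auto

text \<open>Meant for measurability: along one sequence the left derivative is expressed through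
  countably many values of the function.\<close>

lemma left_deriv_convex_on_lim:
  assumes "convex_on UNIV \<phi>"
  shows "(\<lambda>n. real (Suc n) * (\<phi> x - \<phi> (x - 1 / real (Suc n)))) \<longlonglongrightarrow> left_deriv \<phi> x"
proof -
  have 1: "((\<lambda>y. (\<phi> y - \<phi> x) / (y - x)) \<longlongrightarrow> left_deriv \<phi> x) (at_left x)"
    using convex_on_has_left_derivative[OF assms, of x]
    unfolding left_deriv_convex_on[OF assms] has_field_derivative_iff .
  have "(\<lambda>n. x - 1 / real (Suc n)) \<longlonglongrightarrow> x - 0"
    by (rule tendsto_diff[OF tendsto_const LIMSEQ_Suc[OF lim_1_over_n]])
  then have "filterlim (\<lambda>n. x - 1 / real (Suc n)) (at_left x) sequentially"
    unfolding filterlim_at by (intro conjI always_eventually allI) simp_all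
  from filterlim_compose[OF 1 this]
  have 2: "(\<lambda>n. (\<phi> (x - 1 / real (Suc n)) - \<phi> x) / (x - 1 / real (Suc n) - x))
    \<longlonglongrightarrow> left_deriv \<phi> x" .
  have "(a - b) / (x - 1 / r - x) = r * (b - a)" if "r \<noteq> 0" for a b r :: real
  proof -
    have "(a - b) / (x - 1 / r - x) = (a - b) / (- (1 / r))" by simp
    also have "\<dots> = r * (b - a)" using that by (simp add: algebra_simps)
    finally show ?thesis .
  qed
  from this[OF of_nat_neq_0] 2 show ?thesis by (simp only:)
qed

text \<open>The line lifts the minorant at 0 to at least \<open>b\<close>, whatever its slope
  \<open>s\<close>, while the point at \<open>t\<close> keeps it below \<open>b + a * t\<close>.
  Since \<open>t < 0\<close>, the difference quotient between the two exceeds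
  \<open>a\<close>.\<close>

lemma left_deriv_gcm_greater:
  assumes D: "two_sided_unbounded D" and line: "\<And>u. u \<in> D \<Longrightarrow> b + s * u \<le> X u"
    and t: "t \<in> D" "t < 0" and a: "X t < b + a * t"
  shows "a < left_deriv (gcm (graph_on D X)) 0"
proof -
  let ?g = "gcm (graph_on D X)"
  have m: "convex_minorant (graph_on D X) (\<lambda>u. b + s * u)"
    using line by (simp add: convex_minorant_graph_on convex_on_affine)
  have g: "convex_minorant (graph_on D X) ?g" by (rule convex_minorant_gcm[OF D m])
  have "b \<le> ?g 0" using gcm_upper[OF D m, of 0] by simp
  moreover have "?g t \<le> X t" using g t by (auto simp: convex_minorant_graph_on)
  ultimately have "?g t - ?g 0 < a * t" using a by linarith
  then have "a < (?g t - ?g 0) / (t - 0)" using t by (simp add: neg_less_divide_eq)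
  also have "\<dots> \<le> left_deriv ?g 0"
    using g t by (intro le_left_deriv) (auto simp: convex_minorant_graph_on)
  finally show ?thesis .
qed

text \<open>Here \<open>t > 0\<close>, so the quotient from 0 to \<open>t\<close> is below
  \<open>a\<close>; by convexity it dominates the left derivative.\<close>

lemma left_deriv_gcm_less:
  assumes D: "two_sided_unbounded D" and line: "\<And>u. u \<in> D \<Longrightarrow> b + s * u \<le> X u"
    and t: "t \<in> D" "0 < t" and a: "X t < b + a * t"
  shows "left_deriv (gcm (graph_on D X)) 0 < a"
proof -
  let ?g = "gcm (graph_on D X)"
  have m: "convex_minorant (graph_on D X) (\<lambda>u. b + s * u)"
    using line by (simp add: convex_minorant_graph_on convex_on_affine)
  have g: "convex_minorant (graph_on D X) ?g" by (rule convex_minorant_gcm[OF D m])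
  have "b \<le> ?g 0" using gcm_upper[OF D m, of 0] by simp
  moreover have "?g t \<le> X t" using g t by (auto simp: convex_minorant_graph_on)
  ultimately have "?g t - ?g 0 < a * t" using a by linarith
  then have "(?g t - ?g 0) / (t - 0) < a" using t by (simp add: pos_divide_less_eq)
  moreover have "left_deriv ?g 0 \<le> (?g t - ?g 0) / (t - 0)"
    using g t by (intro left_deriv_le_slope) (auto simp: convex_minorant_graph_on)
  ultimately show ?thesis by linarith
qed

text \<open>The weak inequality at a touching point. For \<open>t = 0\<close> all left quotients are
  bounded by the slope of the touching line, so a left derivative puts this boundary case on the
  side of \<open>\<le>\<close>.\<close>

lemma left_deriv_gcm_le:
  assumes D: "two_sided_unbounded D" and line: "\<And>u. u \<in> D \<Longrightarrow> b + a * u \<le> X u"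
    and t: "t \<in> D" "0 \<le> t" and a: "X t = b + a * t"
  shows "left_deriv (gcm (graph_on D X)) 0 \<le> a"
proof -
  let ?g = "gcm (graph_on D X)"
  have m: "convex_minorant (graph_on D X) (\<lambda>u. b + a * u)"
    using line by (simp add: convex_minorant_graph_on convex_on_affine)
  have g: "convex_minorant (graph_on D X) ?g" by (rule convex_minorant_gcm[OF D m])
  have cv: "convex_on UNIV ?g" using g by (simp add: convex_minorant_graph_on)
  have ge: "b + a * u \<le> ?g u" for u using gcm_upper[OF D m, of u] by simp
  have gt: "?g t \<le> b + a * t" using g t a by (auto simp: convex_minorant_graph_on)
  show ?thesis
  proof (cases "t = 0")
    case True
    show ?thesis
    proof (rule left_deriv_le[OF cv])
      fix y :: real assume "y < 0"
      then show "(?g y - ?g 0) / (y - 0) \<le> a"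
        using ge[of y] gt True by (simp add: neg_divide_le_eq)
    qed
  next
    case False
    then have "left_deriv ?g 0 \<le> (?g t - ?g 0) / (t - 0)"
      using t by (intro left_deriv_le_slope cv) auto
    also have "\<dots> \<le> a" using False t ge[of 0] gt by (simp add: pos_divide_le_eq)
    finally show ?thesis .
  qed
qed

text \<open>With \<open>D\<close> countable, the existence of a minorant and the superlevel sets of
  \<open>gcm\<close> are countable combinations of conditions on chords; the derivative is then a
  limit of measurable functions.\<close>

lemma borel_measurable_left_deriv_gcm:
  assumes D: "two_sided_unbounded D" "countable D"
    and X: "\<And>u. u \<in> D \<Longrightarrow> (\<lambda>\<omega>. X \<omega> u) \<in> borel_measurable M"
  shows "(\<lambda>\<omega>. left_deriv (gcm (graph_on D (X \<omega>))) x) \<in> borel_measurable M"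
proof -
  have [measurable]: "(\<lambda>\<omega>. chord (X \<omega>) p q y) \<in> borel_measurable M" if "p \<in> D" "q \<in> D" for p q y
    unfolding chord_def using X[OF that(1)] X[OF that(2)] by measurable
  have chords[measurable]: "Measurable.pred M
      (\<lambda>\<omega>. \<forall>p\<in>D. \<forall>q\<in>D. p \<le> y \<and> y < q \<longrightarrow> r \<le> chord (X \<omega>) p q y)" for r y
    using D(2) by measurable
  define E where "E \<omega> \<longleftrightarrow> (\<exists>\<phi>. convex_minorant (graph_on D (X \<omega>)) \<phi>)" for \<omega>
  have [measurable]: "Measurable.pred M E"
    unfolding E_def ex_convex_minorant_iff[OF D(1), of _ x] by measurable
  \<comment> \<open>Without a minorant \<open>gcm\<close> is constantly \<open>Sup {}\<close>, kept
    as an unspecified \<open>k\<close>. Constant functions are convex, so the limit formula for the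
    left derivative covers these paths too.\<close>
  define k where "k = Sup ({} :: real set)"
  have k: "gcm (graph_on D (X \<omega>)) y = k" if "\<not> E \<omega>" for \<omega> y
    using that by (auto simp: E_def gcm_eq k_def)
  have "(\<lambda>\<omega>. gcm (graph_on D (X \<omega>)) y) \<in> borel_measurable M" for y
    unfolding borel_measurable_iff_ge
  proof
    fix r
    have "{\<omega> \<in> space M. r \<le> gcm (graph_on D (X \<omega>)) y} = {\<omega> \<in> space M. if E \<omega>
      then \<forall>p\<in>D. \<forall>q\<in>D. p \<le> y \<and> y < q \<longrightarrow> r \<le> chord (X \<omega>) p q y else r \<le> k}"
    proof (intro Collect_cong conj_cong refl)
      fix \<omega>
      show "r \<le> gcm (graph_on D (X \<omega>)) y \<longleftrightarrow> (if E \<omega>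
        then \<forall>p\<in>D. \<forall>q\<in>D. p \<le> y \<and> y < q \<longrightarrow> r \<le> chord (X \<omega>) p q y else r \<le> k)"
      proof (cases "E \<omega>")
        case True
        then obtain \<phi> where "convex_minorant (graph_on D (X \<omega>)) \<phi>" unfolding E_def by blast
        from le_gcm_iff[OF D(1) this] True show ?thesis by simp
      qed (simp add: k)
    qed
    also have "\<dots> \<in> sets M" by measurable
    finally show "{\<omega> \<in> space M. r \<le> gcm (graph_on D (X \<omega>)) y} \<in> sets M" .
  qed
  note [measurable] = this
  show ?thesis
  proof (rule borel_measurable_LIMSEQ_real)
    fix \<omega>
    have "convex_on UNIV (gcm (graph_on D (X \<omega>)))"
    proof (cases "E \<omega>")
      case True
      then show ?thesis
        using convex_minorant_gcm[OF D(1)] by (auto simp: E_def convex_minorant_graph_on)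
    next
      case False
      then have "gcm (graph_on D (X \<omega>)) = (\<lambda>_. k)" using k by blast
      then show ?thesis by (simp add: convex_on_const)
    qed
    then show "(\<lambda>n. real (Suc n) * (gcm (graph_on D (X \<omega>)) x
        - gcm (graph_on D (X \<omega>)) (x - 1 / real (Suc n)))) \<longlonglongrightarrow> left_deriv (gcm (graph_on D (X \<omega>))) x"
      by (rule left_deriv_convex_on_lim)
  qed measurable
qed

section \<open>Growth of Brownian paths\<close>

text \<open>A dyadic point of level \<open>m\<close> either belongs to level \<open>m - 1\<close>
  already or is the right neighbour, at level \<open>m\<close>, of such a point. Walking back to 0
  takes at most one step per level.\<close>

lemma dyadic_chaining:
  fixes w :: "real \<Rightarrow> real"
  assumes incr: "\<And>j k. k < 2 ^ j \<Longrightarrow> \<bar>w (real (Suc k) / 2 ^ j) - w (real k / 2 ^ j)\<bar> \<le> b j"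
    and b: "\<And>j. 0 \<le> b j" and "k \<le> 2 ^ m"
  shows "\<bar>w (real k / 2 ^ m) - w 0\<bar> \<le> (\<Sum>j\<le>m. b j)"
  using \<open>k \<le> 2 ^ m\<close>
proof (induction m arbitrary: k)
  case 0
  then consider "k = 0" | "k = 1" by force
  then show ?case using incr[of 0 0] b[of 0] by cases auto
next
  case (Suc m)
  have half: "real (2 * i) / 2 ^ Suc m = real i / 2 ^ m" for i by simp
  show ?case
  proof (cases "even k")
    case True
    then obtain i where i: "k = 2 * i" by (elim evenE)
    then have "\<bar>w (real i / 2 ^ m) - w 0\<bar> \<le> (\<Sum>j\<le>m. b j)"
      using Suc.prems by (intro Suc.IH) simp
    then show ?thesis using b[of "Suc m"] half[of i] i by simp
  next
    case False
    then obtain i where i: "k = Suc (2 * i)" by (auto elim: oddE)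
    then have "2 * i < 2 ^ Suc m" using Suc.prems by simp
    then have "\<bar>w (real i / 2 ^ m) - w 0\<bar> \<le> (\<Sum>j\<le>m. b j)"
      by (intro Suc.IH) simp
    moreover have "\<bar>w (real k / 2 ^ Suc m) - w (real i / 2 ^ m)\<bar> \<le> b (Suc m)"
      using incr[OF \<open>2 * i < 2 ^ Suc m\<close>] unfolding i half .
    moreover have "(\<Sum>j\<le>Suc m. b j) = (\<Sum>j\<le>m. b j) + b (Suc m)" by simp
    ultimately show ?thesis by linarith
  qed
qed

lemma dyadic_chaining_continuous:
  fixes w :: "real \<Rightarrow> real"
  assumes w: "continuous_on UNIV w"
    and incr: "\<And>j k. k < 2 ^ j \<Longrightarrow> \<bar>w (real (Suc k) / 2 ^ j) - w (real k / 2 ^ j)\<bar> \<le> b j"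
    and b: "\<And>j. 0 \<le> b j" "b sums B" and s: "0 \<le> s" "s \<le> 1"
  shows "\<bar>w s - w 0\<bar> \<le> B"
proof -
  define k where "k m = nat \<lfloor>s * 2 ^ m\<rfloor>" for m
  have k: "real (k m) \<le> s * 2 ^ m" "s * 2 ^ m - 1 \<le> real (k m)" for m
    using s by (simp_all add: k_def of_nat_nat)
  have k_le: "k m \<le> 2 ^ m" for m
  proof -
    have "s * 2 ^ m \<le> 1 * 2 ^ m" using s by (intro mult_right_mono) auto
    then have "real (k m) \<le> 2 ^ m" using k(1)[of m] by linarith
    then have "real (k m) \<le> real (2 ^ m)" by simp
    then show ?thesis by linarith
  qed
  have "(\<lambda>m. real (k m) / 2 ^ m) \<longlonglongrightarrow> s"
  proof (rule tendsto_sandwich)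
    show "\<forall>\<^sub>F m in sequentially. s - (1 / 2) ^ m \<le> real (k m) / 2 ^ m"
    proof (intro always_eventually allI)
      fix m
      have "(s * 2 ^ m - 1) / 2 ^ m \<le> real (k m) / 2 ^ m"
        using k(2) by (rule divide_right_mono) simp
      then show "s - (1 / 2) ^ m \<le> real (k m) / 2 ^ m"
        by (simp add: diff_divide_distrib power_divide)
    qed
    show "\<forall>\<^sub>F m in sequentially. real (k m) / 2 ^ m \<le> s"
      using k(1) by (intro always_eventually allI) (simp add: pos_divide_le_eq)
    have "(\<lambda>m. s - (1 / 2) ^ m) \<longlonglongrightarrow> s - 0"
      by (intro tendsto_diff tendsto_const LIMSEQ_realpow_zero) auto
    then show "(\<lambda>m. s - (1 / 2) ^ m) \<longlonglongrightarrow> s" by simp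
  qed simp
  moreover have "isCont w s" using w by (simp add: continuous_on_eq_continuous_at)
  ultimately have "(\<lambda>m. w (real (k m) / 2 ^ m)) \<longlonglongrightarrow> w s" by (rule isCont_tendsto_compose[rotated])
  then have "(\<lambda>m. \<bar>w (real (k m) / 2 ^ m) - w 0\<bar>) \<longlonglongrightarrow> \<bar>w s - w 0\<bar>"
    by (intro tendsto_intros)
  moreover have "\<bar>w (real (k m) / 2 ^ m) - w 0\<bar> \<le> B" for m
  proof -
    have "\<bar>w (real (k m) / 2 ^ m) - w 0\<bar> \<le> (\<Sum>j\<le>m. b j)"
      by (rule dyadic_chaining[OF incr b(1) k_le])
    also have "\<dots> \<le> B"
      using b sum_le_suminf[of b "{..m}"] by (simp add: sums_iff)
    finally show ?thesis .
  qed
  ultimately show ?thesis by (intro LIMSEQ_le_const2) auto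
qed

text \<open>Linear bounds on unit increments add up to a quadratic one, since
  \<open>(n + 1) / 8\<close> is at most \<open>((n + 1)\<^sup>2 - n\<^sup>2) / 8\<close>. The factor
  1/2 in the result is below 1, so that adding \<open>t\<^sup>2\<close> to the path leaves positive
  curvature.\<close>

lemma quadratic_growth_of_increments:
  fixes w :: "real \<Rightarrow> real"
  assumes w: "continuous_on UNIV w"
    and incr: "\<forall>\<^sub>F n in sequentially. \<forall>s\<in>{0..1}. \<bar>w (real n + s) - w (real n)\<bar> \<le> real (Suc n) / 8"
  shows "\<exists>C. \<forall>t\<ge>0. \<bar>w t\<bar> \<le> t\<^sup>2 / 2 + C"
proof -
  obtain N where N: "\<And>n s. N \<le> n \<Longrightarrow> s \<in> {0..1} \<Longrightarrow>
      \<bar>w (real n + s) - w (real n)\<bar> \<le> real (Suc n) / 8"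
    using incr unfolding eventually_sequentially by blast
  have "compact (w ` {0..real N})"
    by (intro compact_continuous_image continuous_on_subset[OF w]) auto
  then obtain K where K: "\<And>t. t \<in> {0..real N} \<Longrightarrow> \<bar>w t\<bar> \<le> K"
    using compact_imp_bounded[THEN bounded_iff[THEN iffD1]] by (metis image_eqI real_norm_def)
  have int: "\<bar>w (real n)\<bar> \<le> K + (real n)\<^sup>2 / 8" if "N \<le> n" for n
    using that
  proof (induction n rule: dec_induct)
    case base
    have "\<bar>w (real N)\<bar> \<le> K" by (rule K) simp
    moreover have "0 \<le> (real N)\<^sup>2 / 8" by simp
    ultimately show ?case by linarith
  next
    case (step n)
    then have "\<bar>w (real n + 1) - w (real n)\<bar> \<le> real (Suc n) / 8" by (intro N) auto
    moreover have "(real n)\<^sup>2 / 8 + real (Suc n) / 8 \<le> (real (Suc n))\<^sup>2 / 8"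
      by (simp add: power2_eq_square algebra_simps)
    ultimately show ?case using step.IH unfolding of_nat_Suc add.commute[of 1] by linarith
  qed
  have "\<bar>w t\<bar> \<le> t\<^sup>2 / 2 + (K + 1 / 4)" if t: "0 \<le> t" for t
  proof (cases "t \<le> real N")
    case True
    then have "\<bar>w t\<bar> \<le> K" using K t by simp
    moreover have "0 \<le> t\<^sup>2" by simp
    ultimately show ?thesis by linarith
  next
    case False
    define n where "n = nat \<lfloor>t\<rfloor>"
    have n: "real n \<le> t" "t \<le> real n + 1" using t by (simp_all add: n_def of_nat_nat)
    have "N \<le> n" using False t unfolding n_def by (simp add: le_nat_iff le_floor_iff)
    then have "\<bar>w t - w (real n)\<bar> \<le> real (Suc n) / 8"
      using N[of n "t - real n"] n by simp
    with int[OF \<open>N \<le> n\<close>] have "\<bar>w t\<bar> \<le> K + ((real n)\<^sup>2 + real n + 1) / 8"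
      unfolding of_nat_Suc add_divide_distrib by linarith
    also have "(real n)\<^sup>2 + real n + 1 \<le> t\<^sup>2 + t + 1"
      using n t by (intro add_mono power_mono) auto
    also have "(t\<^sup>2 + t + 1) / 8 \<le> t\<^sup>2 / 2 + 1 / 4"
    proof -
      have "2 * t \<le> t\<^sup>2 + 1" using sum_squares_bound[of t 1] by simp
      then show ?thesis using zero_le_power2[of t] by argo
    qed
    finally show ?thesis by (simp add: algebra_simps)
  qed
  then show ?thesis by blast
qed

lemma summable_inverse_Suc_power4: "summable (\<lambda>n. 1 / real (Suc n) ^ 4)"
  using inverse_power_summable[of 4, where 'a = real]
  by (subst summable_Suc_iff[of "\<lambda>n. 1 / real n ^ 4"]) (simp add: inverse_eq_divide)

context two_sided_brownian_motion
begin

text \<open>Second moments are too weak for the chaining: the variances of the \<open>2 ^ j\<close>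
  increments of level \<open>j\<close> add up to 1, and Chebyshev's inequality with tolerances
  tending to 0 then gives no summable bound.\<close>

lemma increment_fourth_moment:
  assumes "s < t"
  shows "integrable M (\<lambda>\<omega>. (W t \<omega> - W s \<omega>) ^ 4)"
    and "(\<integral>\<omega>. (W t \<omega> - W s \<omega>) ^ 4 \<partial>M) = 3 * (t - s)\<^sup>2"
proof -
  let ?\<sigma> = "sqrt (t - s)"
  have m: "has_bochner_integral lborel (\<lambda>x. normal_density 0 ?\<sigma> x * x ^ 4) (3 * (t - s)\<^sup>2)"
  proof -
    have "fact (2 * 2) / ((2 / ?\<sigma>\<^sup>2) ^ 2 * fact 2) = 3 * (t - s)\<^sup>2"
      using assms by (simp add: fact_numeral power_divide)
    moreover have "0 < ?\<sigma>" using assms by simp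
    from normal_moment_even[OF this, of 0 2] have "has_bochner_integral lborel
      (\<lambda>x. normal_density 0 ?\<sigma> x * x ^ 4) (fact (2 * 2) / ((2 / ?\<sigma>\<^sup>2) ^ 2 * fact 2))"
      unfolding diff_zero by simp
    ultimately show ?thesis by (simp only:)
  qed
  have D: "distributed M lborel (\<lambda>\<omega>. W t \<omega> - W s \<omega>) (normal_density 0 ?\<sigma>)"
    by (rule normal_increments[OF assms])
  show "integrable M (\<lambda>\<omega>. (W t \<omega> - W s \<omega>) ^ 4)"
    using distributed_integrable[OF D, of "\<lambda>x. x ^ 4"] m
    by (simp add: has_bochner_integral_iff)
  show "(\<integral>\<omega>. (W t \<omega> - W s \<omega>) ^ 4 \<partial>M) = 3 * (t - s)\<^sup>2"
    using distributed_integral[OF D, of "\<lambda>x. x ^ 4"] m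
    by (simp add: has_bochner_integral_iff)
qed

lemma increment_tail:
  assumes "s < t" "0 < \<epsilon>"
  shows "prob {\<omega> \<in> space M. \<epsilon> < \<bar>W t \<omega> - W s \<omega>\<bar>} \<le> 3 * (t - s)\<^sup>2 / \<epsilon> ^ 4"
proof -
  have [measurable]: "W u \<in> borel_measurable M" for u by (rule measurable_W)
  have "prob {\<omega> \<in> space M. \<epsilon> < \<bar>W t \<omega> - W s \<omega>\<bar>}
      \<le> prob {\<omega> \<in> space M. \<epsilon> ^ 4 \<le> (W t \<omega> - W s \<omega>) ^ 4}"
  proof (intro finite_measure_mono subsetI)
    fix \<omega> assume "\<omega> \<in> {\<omega> \<in> space M. \<epsilon> < \<bar>W t \<omega> - W s \<omega>\<bar>}"
    then have "\<omega> \<in> space M" "\<epsilon> ^ 4 \<le> \<bar>W t \<omega> - W s \<omega>\<bar> ^ 4"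
      using assms power_mono[of \<epsilon> "\<bar>W t \<omega> - W s \<omega>\<bar>" 4] by auto
    then show "\<omega> \<in> {\<omega> \<in> space M. \<epsilon> ^ 4 \<le> (W t \<omega> - W s \<omega>) ^ 4}"
      by (simp add: power_even_abs)
  qed measurable
  also have "\<dots> \<le> (\<integral>\<omega>. (W t \<omega> - W s \<omega>) ^ 4 \<partial>M) / \<epsilon> ^ 4"
    using assms increment_fourth_moment[OF assms(1)]
    by (intro integral_Markov_inequality_measure[where A = "{}"]) auto
  also have "\<dots> = 3 * (t - s)\<^sup>2 / \<epsilon> ^ 4"
    using increment_fourth_moment[OF assms(1)] by simp
  finally show ?thesis .
qed

text \<open>
  The tolerances at dyadic level \<open>j\<close> are proportional to \<open>(7/8)\<^sup>j\<close>: this is summable,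
  while by the fourth moment bound the exceedance probabilities are of order
  \<open>2\<^sup>j (2\<^sup>-\<^sup>j)\<^sup>2 (8/7)\<^sup>4\<^sup>j = (2048/2401)\<^sup>j\<close>, which is summable as well.
\<close>

lemma AE_unit_increments:
  "AE \<omega> in M. \<forall>\<^sub>F n in sequentially. \<forall>s\<in>{0..1}.
     \<bar>W (real n + s) \<omega> - W (real n) \<omega>\<bar> \<le> real (Suc n) / 8"
proof -
  have [measurable]: "W u \<in> borel_measurable M" for u by (rule measurable_W)
  \<comment> \<open>The powers of 7/8 sum to 8, so the tolerances of all levels add up to
    \<open>real (Suc n) / 8\<close>.\<close>
  define b where "b n j = real (Suc n) / 64 * (7 / 8) ^ j" for n j :: nat
  have b_pos: "0 < b n j" for n j by (simp add: b_def)
  define A where "A n j k = {\<omega> \<in> space M. b n j <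
    \<bar>W (real n + real (Suc k) / 2 ^ j) \<omega> - W (real n + real k / 2 ^ j) \<omega>\<bar>}" for n j k :: nat
  have [measurable]: "A n j k \<in> sets M" for n j k unfolding A_def by measurable
  define c where "c = 3 * 64 ^ 4 * (1 / (1 - 2048 / 2401 :: real))"
  have PA: "prob (A n j k) \<le> 3 * (1 / 2 ^ j)\<^sup>2 / b n j ^ 4" for n j k
  proof -
    have "real n + real (Suc k) / 2 ^ j - (real n + real k / 2 ^ j) = 1 / 2 ^ j"
      by (simp add: field_simps)
    then show ?thesis
      unfolding A_def
      using increment_tail[of "real n + real k / 2 ^ j" "real n + real (Suc k) / 2 ^ j", OF _ b_pos]
      by (simp add: divide_strict_right_mono)
  qed
  have PU: "prob (\<Union>k<2 ^ j. A n j k) \<le> 3 * 64 ^ 4 / real (Suc n) ^ 4 * (2048 / 2401) ^ j" for n j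
  proof -
    have "prob (\<Union>k<2 ^ j. A n j k) \<le> (\<Sum>k<2 ^ j. prob (A n j k))"
      by (intro finite_measure_subadditive_finite) auto
    also have "\<dots> \<le> (\<Sum>k<(2::nat) ^ j. 3 * (1 / 2 ^ j)\<^sup>2 / b n j ^ 4)"
      by (intro sum_mono PA)
    also have "\<dots> = 2 ^ j * (3 * (1 / 2 ^ j)\<^sup>2 / b n j ^ 4)" by simp
    also have "\<dots> = 3 * 64 ^ 4 / real (Suc n) ^ 4 * (1 / 2 ^ j * (1 / ((7 / 8) ^ j) ^ 4))"
      by (simp add: b_def power_mult_distrib power_divide power2_eq_square)
    also have "((7 / 8) ^ j) ^ 4 = ((7 / 8) ^ 4 :: real) ^ j"
      by (simp only: power_mult[symmetric] mult.commute)
    also have "1 / 2 ^ j * (1 / ((7 / 8) ^ 4) ^ j) = (1 / 2 * (1 / (7 / 8) ^ 4) :: real) ^ j"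
      by (simp only: power_mult_distrib power_one_over power_divide power_one)
    also have "1 / 2 * (1 / (7 / 8) ^ 4) = (2048 / 2401 :: real)"
      by (simp add: power_divide)
    finally show ?thesis .
  qed
  have geo: "(\<lambda>j. a * (2048 / 2401) ^ j) sums (a * (1 / (1 - 2048 / 2401)))" for a :: real
    by (intro sums_mult geometric_sums) simp
  \<comment> \<open>The factor \<open>1 / real (Suc n) ^ 4\<close> comes from tolerances growing
    linearly in \<open>n\<close>; it makes the Borel-Cantelli lemma applicable across the unit
    intervals.\<close>
  have PUU: "prob (\<Union>j. \<Union>k<2 ^ j. A n j k) \<le> c * (1 / real (Suc n) ^ 4)" for n
  proof -
    have s: "summable (\<lambda>j. prob (\<Union>k<2 ^ j. A n j k))"
      by (rule summable_comparison_test'[OF sums_summable[OF geo[of "3 * 64 ^ 4 / real (Suc n) ^ 4"]]])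
        (use PU[of n] in simp)
    have "prob (\<Union>j. \<Union>k<2 ^ j. A n j k) \<le> (\<Sum>j. prob (\<Union>k<2 ^ j. A n j k))"
      using s by (intro finite_measure_subadditive_countably) auto
    also have "\<dots> \<le> (\<Sum>j. 3 * 64 ^ 4 / real (Suc n) ^ 4 * (2048 / 2401) ^ j)"
      using s by (intro suminf_le PU sums_summable[OF geo])
    also have "\<dots> = c * (1 / real (Suc n) ^ 4)"
      unfolding sums_unique[OF geo, symmetric] by (simp add: c_def)
    finally show ?thesis .
  qed
  have "AE \<omega> in M. \<forall>\<^sub>F n in sequentially. \<omega> \<in> space M - (\<Union>j. \<Union>k<2 ^ j. A n j k)"
  proof (rule borel_cantelli_AE1)
    show "summable (\<lambda>n. prob (\<Union>j. \<Union>k<2 ^ j. A n j k))"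
      by (rule summable_comparison_test'[OF summable_mult[OF summable_inverse_Suc_power4]])
        (use PUU in auto)
  qed (auto simp: emeasure_eq_measure)
  then show ?thesis
  proof (rule AE_mp, intro AE_I2 impI)
    fix \<omega> assume \<omega>: "\<omega> \<in> space M"
      and ev: "\<forall>\<^sub>F n in sequentially. \<omega> \<in> space M - (\<Union>j. \<Union>k<2 ^ j. A n j k)"
    from ev show "\<forall>\<^sub>F n in sequentially. \<forall>s\<in>{0..1}.
        \<bar>W (real n + s) \<omega> - W (real n) \<omega>\<bar> \<le> real (Suc n) / 8"
    proof (eventually_elim, intro ballI)
      fix n and s :: real
      assume n: "\<omega> \<in> space M - (\<Union>j. \<Union>k<2 ^ j. A n j k)" and s: "s \<in> {0..1}"
      have "\<bar>W (real n + s) \<omega> - W (real n + 0) \<omega>\<bar> \<le> real (Suc n) / 64 * (1 / (1 - 7 / 8))"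
      proof (rule dyadic_chaining_continuous[where w = "\<lambda>s. W (real n + s) \<omega>" and b = "b n"])
        show "continuous_on UNIV (\<lambda>s. W (real n + s) \<omega>)"
          by (intro continuous_on_compose2[OF continuous_paths[OF \<omega>]] continuous_intros) auto
        show "b n sums (real (Suc n) / 64 * (1 / (1 - 7 / 8)))"
          unfolding b_def by (intro sums_mult geometric_sums) simp
        show "0 \<le> b n j" for j using b_pos[of n j] by simp
        show "\<bar>W (real n + real (Suc k) / 2 ^ j) \<omega> - W (real n + real k / 2 ^ j) \<omega>\<bar> \<le> b n j"
          if "k < 2 ^ j" for j k
          using n that by (auto simp: A_def not_less)
      qed (use s in auto)
      then show "\<bar>W (real n + s) \<omega> - W (real n) \<omega>\<bar> \<le> real (Suc n) / 8" by simp
    qed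
  qed
qed

lemma AE_growth_nonneg: "AE \<omega> in M. \<exists>C. \<forall>t\<ge>0. \<bar>W t \<omega>\<bar> \<le> t\<^sup>2 / 2 + C"
  using AE_unit_increments
  by (rule AE_mp) (intro AE_I2 impI quadratic_growth_of_increments continuous_paths)

end

section \<open>The law of Brownian motion\<close>

text \<open>Serves to list increments in reverse order, with \<open>f\<close> the reversal of
  \<open>{..<n}\<close>.\<close>

lemma (in prob_space) indep_vars_reindex_inj:
  assumes f: "inj_on f I" and X: "indep_vars N X (f ` I)"
  shows "indep_vars (\<lambda>i. N (f i)) (\<lambda>i. X (f i)) I"
  unfolding indep_vars_def2
proof (intro conjI ballI)
  show "random_variable (N (f i)) (X (f i))" if "i \<in> I" for i
    using X that by (auto simp: indep_vars_def2)
  let ?F = "\<lambda>i. {X i -` A \<inter> space M | A. A \<in> sets (N i)}"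
  have F: "indep_sets ?F (f ` I)" using X by (simp add: indep_vars_def2)
  show "indep_sets (\<lambda>i. ?F (f i)) I"
  proof (rule indep_setsI)
    show "?F (f i) \<subseteq> events" if "i \<in> I" for i
      using F that unfolding indep_sets_def by blast
  next
    fix A J assume J: "J \<noteq> {}" "J \<subseteq> I" "finite J" and A: "\<forall>j\<in>J. A j \<in> ?F (f j)"
    have inj: "inj_on f J" using f J(2) by (rule inj_on_subset)
    define A' where "A' = A \<circ> the_inv_into J f"
    have A': "A' (f j) = A j" if "j \<in> J" for j
      using that inj by (simp add: A'_def the_inv_into_f_f)
    have "prob (\<Inter>j\<in>f ` J. A' j) = (\<Prod>j\<in>f ` J. prob (A' j))"
      by (rule indep_setsD[OF F]) (use J A A' in auto)
    then show "prob (\<Inter>j\<in>J. A j) = (\<Prod>j\<in>J. prob (A j))"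
      using A' inj by (simp add: prod.reindex)
  qed
qed

text \<open>Reflection, shift of the origin to \<open>h\<close> and Brownian scaling in one step.
  The reflection gives access to negative times and later turns a nonnegative minimizer into an
  upper bound on a Chernoff minimizer.\<close>

lemma (in two_sided_brownian_motion) reversed_brownian_motion:
  assumes l: "0 < l"
  shows "two_sided_brownian_motion M (\<lambda>s \<omega>. (W (h - l * s) \<omega> - W h \<omega>) / sqrt l)"
proof
  note [measurable] = measurable_W
  show "(\<lambda>\<omega>. (W (h - l * s) \<omega> - W h \<omega>) / sqrt l) \<in> borel_measurable M" for s
    by measurable
  show "(W (h - l * 0) \<omega> - W h \<omega>) / sqrt l = 0" for \<omega> by simp
  show "continuous_on UNIV (\<lambda>t. (W (h - l * t) \<omega> - W h \<omega>) / sqrt l)" if "\<omega> \<in> space M" for \<omega>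
    by (intro continuous_intros continuous_on_compose2[OF continuous_paths[OF that]]) (use l in auto)
next
  fix s t :: real assume "s < t"
  then have less: "h - l * t < h - l * s" using l by simp
  have "distributed M lborel (\<lambda>\<omega>. 0 + - (1 / sqrt l) * (W (h - l * s) \<omega> - W (h - l * t) \<omega>))
      (normal_density (0 + - (1 / sqrt l) * 0) (\<bar>- (1 / sqrt l)\<bar> * sqrt (h - l * s - (h - l * t))))"
    by (rule normal_density_affine[OF normal_increments[OF less]]) (use l less in auto)
  moreover have "\<bar>- (1 / sqrt l)\<bar> * sqrt (h - l * s - (h - l * t)) = sqrt (t - s)"
  proof -
    have "h - l * s - (h - l * t) = l * (t - s)" by (simp add: algebra_simps)
    then show ?thesis using l by (simp add: real_sqrt_mult)
  qed
  ultimately show "distributed M lborel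
      (\<lambda>\<omega>. (W (h - l * t) \<omega> - W h \<omega>) / sqrt l - (W (h - l * s) \<omega> - W h \<omega>) / sqrt l)
      (normal_density 0 (sqrt (t - s)))"
    by (simp add: diff_divide_distrib)
next
  fix t :: "nat \<Rightarrow> real" and n :: nat assume t: "mono t"
  \<comment> \<open>The reversed times, again increasing. Truncated subtraction freezes
    \<open>v\<close> beyond \<open>n\<close>, so monotonicity holds for all indices, as
    \<open>indep_increments\<close> demands.\<close>
  define v where "v j = h - l * t (n - j)" for j
  have v: "mono v"
    using l t by (auto simp: v_def mono_def intro!: mult_left_mono)
  define E where "E j \<omega> = W (v (Suc j)) \<omega> - W (v j) \<omega>" for j \<omega>
  define f where "f i = n - 1 - i" for i
  have f: "inj_on f {..<n}" "f ` {..<n} = {..<n}"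
  proof -
    show "inj_on f {..<n}" by (auto simp: f_def inj_on_def)
    moreover have "f ` {..<n} \<subseteq> {..<n}" by (auto simp: f_def)
    ultimately show "f ` {..<n} = {..<n}" by (intro endo_inj_surj) auto
  qed
  have "indep_vars (\<lambda>_. borel) E (f ` {..<n})"
    unfolding f E_def by (rule indep_increments[OF v])
  from indep_vars_reindex_inj[OF f(1) this]
  have "indep_vars (\<lambda>_. borel) (\<lambda>i. E (f i)) {..<n}" .
  then have "indep_vars (\<lambda>_. borel) (\<lambda>i \<omega>. - (1 / sqrt l) * E (f i) \<omega>) {..<n}"
    by (rule indep_vars_compose2) simp
  moreover have "- (1 / sqrt l) * E (f i) \<omega>
      = (W (h - l * t (Suc i)) \<omega> - W h \<omega>) / sqrt l - (W (h - l * t i) \<omega> - W h \<omega>) / sqrt l"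
    if "i < n" for i \<omega>
  proof -
    have "n - Suc (n - 1 - i) = i" "n - (n - 1 - i) = Suc i" using that by auto
    then show ?thesis by (simp add: E_def f_def v_def diff_divide_distrib)
  qed
  ultimately show "indep_vars (\<lambda>_. borel)
      (\<lambda>i \<omega>. (W (h - l * t (Suc i)) \<omega> - W h \<omega>) / sqrt l - (W (h - l * t i) \<omega> - W h \<omega>) / sqrt l) {..<n}"
    by (subst (asm) indep_vars_cong[OF refl _ refl]) (auto simp: fun_eq_iff)
qed

lemma (in two_sided_brownian_motion) distr_increments:
  assumes t: "mono t" "\<And>i. i < n \<Longrightarrow> t i < t (Suc i)" and n: "0 < n"
  shows "distr M (\<Pi>\<^sub>M i\<in>{..<n}. borel) (\<lambda>\<omega>. \<lambda>i\<in>{..<n}. W (t (Suc i)) \<omega> - W (t i) \<omega>) =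
    (\<Pi>\<^sub>M i\<in>{..<n}. density lborel (normal_density 0 (sqrt (t (Suc i) - t i))))"
proof -
  note [measurable] = measurable_W
  have "distr M (\<Pi>\<^sub>M i\<in>{..<n}. borel) (\<lambda>\<omega>. \<lambda>i\<in>{..<n}. W (t (Suc i)) \<omega> - W (t i) \<omega>) =
      (\<Pi>\<^sub>M i\<in>{..<n}. distr M borel (\<lambda>\<omega>. W (t (Suc i)) \<omega> - W (t i) \<omega>))"
    by (rule indep_vars_iff_distr_eq_PiM[THEN iffD1, OF _ _ indep_increments[OF t(1)]]) (use n in auto)
  also have "\<dots> = (\<Pi>\<^sub>M i\<in>{..<n}. density lborel (normal_density 0 (sqrt (t (Suc i) - t i))))"
  proof (intro PiM_cong refl)
    fix i assume "i \<in> {..<n}"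
    then have "distr M lborel (\<lambda>\<omega>. W (t (Suc i)) \<omega> - W (t i) \<omega>)
        = density lborel (normal_density 0 (sqrt (t (Suc i) - t i)))"
      using t(2) by (intro distributed_distr_eq_density normal_increments) auto
    moreover have "distr M borel (\<lambda>\<omega>. W (t (Suc i)) \<omega> - W (t i) \<omega>)
        = distr M lborel (\<lambda>\<omega>. W (t (Suc i)) \<omega> - W (t i) \<omega>)"
      by (rule distr_cong) auto
    ultimately show "distr M borel (\<lambda>\<omega>. W (t (Suc i)) \<omega> - W (t i) \<omega>)
        = density lborel (normal_density 0 (sqrt (t (Suc i) - t i)))" by simp
  qed
  finally show ?thesis .
qed

text \<open>Along times that include 0, partial sums of increments give \<open>W u\<close> and
  \<open>W 0 = 0\<close> up to the same initial value. Hence \<open>W u\<close> is a difference of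
  two partial sums, and \<open>distr_increments\<close> determines the joint law.\<close>

lemma brownian_fdd_unique:
  assumes W: "two_sided_brownian_motion M W" and B: "two_sided_brownian_motion N B"
    and J: "finite J" and A: "\<And>u. u \<in> J \<Longrightarrow> A u \<in> sets borel"
  shows "emeasure M {\<omega> \<in> space M. \<forall>u\<in>J. W u \<omega> \<in> A u} = emeasure N {\<omega> \<in> space N. \<forall>u\<in>J. B u \<omega> \<in> A u}"
proof -
  \<comment> \<open>Adding 0 anchors the path at its known value; adding 1 guarantees two distinct
    times, hence at least one increment.\<close>
  define L where "L = sorted_list_of_set (insert 0 (insert 1 J))"
  have L: "sorted L" "distinct L" "set L = insert 0 (insert 1 J)"
    unfolding L_def using J
    by (simp_all only: sorted_sorted_list_of_set distinct_sorted_list_of_set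
        set_sorted_list_of_set finite_insert)
  define n where "n = length L - 1"
  have "card (insert 0 (insert 1 J)) \<ge> card {0::real, 1}"
    using J by (intro card_mono) auto
  then have len: "length L = Suc n" and n: "0 < n"
    using L distinct_card[of L] by (auto simp: n_def)
  \<comment> \<open>Constant beyond the last time, which keeps \<open>t\<close> monotone on all of
    \<open>nat\<close>.\<close>
  define t where "t i = L ! min i n" for i
  have t_mono: "mono t"
    unfolding t_def mono_def using L(1) len by (auto intro!: sorted_nth_mono)
  have t_less: "t i < t (Suc i)" if "i < n" for i
    using that L(1,2) len sorted_wrt_nth_less[of "(<)" L i "Suc i"]
    by (auto simp: t_def strict_sorted_iff min_absorb1)
  have "\<exists>i\<le>n. t i = u" if "u \<in> insert 0 J" for u
  proof -
    have "u \<in> set L" using that L(3) by auto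
    then obtain i where "i < length L" "L ! i = u" by (auto simp: in_set_conv_nth)
    then show ?thesis using len by (intro exI[of _ i]) (auto simp: t_def)
  qed
  then obtain k where k: "\<And>u. u \<in> insert 0 J \<Longrightarrow> k u \<le> n \<and> t (k u) = u" by metis
  define S where "S = {x \<in> space (\<Pi>\<^sub>M i\<in>{..<n}. borel :: real measure).
    \<forall>u\<in>J. (\<Sum>i<k u. x i) - (\<Sum>i<k 0. x i) \<in> A u}"
  have comp: "(\<lambda>x. (\<Sum>i<k u. x i) - (\<Sum>i<k 0. x i)) \<in> borel_measurable (\<Pi>\<^sub>M i\<in>{..<n}. borel :: real measure)"
    if "u \<in> J" for u
    using k[of u] k[of 0] that
    by (intro borel_measurable_diff borel_measurable_sum measurable_component_singleton) auto
  have "S \<in> sets (\<Pi>\<^sub>M i\<in>{..<n}. borel)"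
  proof (cases "J = {}")
    case False
    then show ?thesis
      unfolding S_def using J A comp
      by (intro sets.sets_Collect_finite_All') (auto intro: measurable_sets_Collect)
  qed (auto simp: S_def)
  note S = this
  have *: "emeasure M' {\<omega> \<in> space M'. \<forall>u\<in>J. X u \<omega> \<in> A u} =
      emeasure (\<Pi>\<^sub>M i\<in>{..<n}. density lborel (normal_density 0 (sqrt (t (Suc i) - t i)))) S"
    if X: "two_sided_brownian_motion M' X" for M' :: "'c measure" and X
  proof -
    interpret X: two_sided_brownian_motion M' X by (rule X)
    note [measurable] = X.measurable_W
    let ?V = "\<lambda>\<omega>. \<lambda>i\<in>{..<n}. X (t (Suc i)) \<omega> - X (t i) \<omega>"
    have V: "?V \<in> measurable M' (\<Pi>\<^sub>M i\<in>{..<n}. borel)" by measurable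
    have "X u \<omega> = (\<Sum>i<k u. ?V \<omega> i) - (\<Sum>i<k 0. ?V \<omega> i)" if "u \<in> J" "\<omega> \<in> space M'" for u \<omega>
    proof -
      have tele: "(\<Sum>i<k u. ?V \<omega> i) = X (t (k u)) \<omega> - X (t 0) \<omega>" if "u \<in> insert 0 J" for u
      proof -
        have "(\<Sum>i<k u. ?V \<omega> i) = (\<Sum>i<k u. X (t (Suc i)) \<omega> - X (t i) \<omega>)"
          using k[OF that] by (intro sum.cong) auto
        then show ?thesis by (simp add: sum_lessThan_telescope[of "\<lambda>i. X (t i) \<omega>"])
      qed
      show ?thesis
        unfolding tele[OF insertI1] tele[OF insertI2[OF that(1)]]
        using that k[of u] k[of 0] X.W_zero[of \<omega>] by simp
    qed
    then have "{\<omega> \<in> space M'. \<forall>u\<in>J. X u \<omega> \<in> A u} = ?V -` S \<inter> space M'"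
      using measurable_space[OF V] by (auto simp: S_def)
    also have "emeasure M' \<dots> = emeasure (distr M' (\<Pi>\<^sub>M i\<in>{..<n}. borel) ?V) S"
      by (rule emeasure_distr[OF V S, symmetric])
    also have "distr M' (\<Pi>\<^sub>M i\<in>{..<n}. borel) ?V =
        (\<Pi>\<^sub>M i\<in>{..<n}. density lborel (normal_density 0 (sqrt (t (Suc i) - t i))))"
      by (rule X.distr_increments[OF t_mono t_less n])
    finally show ?thesis .
  qed
  from *[OF W] *[OF B] show ?thesis by simp
qed

lemma (in two_sided_brownian_motion) measurable_path:
  "(\<lambda>\<omega> t. W t \<omega>) \<in> measurable M (\<Pi>\<^sub>M t\<in>UNIV. borel)"
  by (rule measurable_PiM_single') (use measurable_W in auto)

lemma brownian_path_law_unique: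
  assumes W: "two_sided_brownian_motion M W" and B: "two_sided_brownian_motion N B"
  shows "distr M (\<Pi>\<^sub>M t\<in>UNIV. borel) (\<lambda>\<omega> t. W t \<omega>) = distr N (\<Pi>\<^sub>M t\<in>UNIV. borel) (\<lambda>\<omega> t. B t \<omega>)"
proof -
  interpret W: two_sided_brownian_motion M W by (rule W)
  interpret B: two_sided_brownian_motion N B by (rule B)
  note mW = W.measurable_path and mB = B.measurable_path
  show ?thesis
  proof (rule measure_eqI_PiM_infinite)
    fix A and J :: "real set"
    assume J: "finite J" and A: "\<And>u. u \<in> J \<Longrightarrow> A u \<in> sets (borel :: real measure)"
    let ?C = "prod_emb UNIV (\<lambda>_. borel :: real measure) J (Pi\<^sub>E J A)"
    have C: "?C \<in> sets (\<Pi>\<^sub>M t\<in>UNIV. borel)" using J A by (intro sets_PiM_I) auto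
    have eq: "x \<in> ?C \<longleftrightarrow> (\<forall>u\<in>J. x u \<in> A u)" for x
      by (auto simp: prod_emb_def space_PiM PiE_iff)
    show "emeasure (distr M (\<Pi>\<^sub>M t\<in>UNIV. borel) (\<lambda>\<omega> t. W t \<omega>)) ?C =
        emeasure (distr N (\<Pi>\<^sub>M t\<in>UNIV. borel) (\<lambda>\<omega> t. B t \<omega>)) ?C"
      using brownian_fdd_unique[OF W B J A]
      by (simp add: emeasure_distr[OF mW C] emeasure_distr[OF mB C] vimage_def eq Int_def conj_commute)
  next
    show "finite_measure (distr M (\<Pi>\<^sub>M t\<in>UNIV. borel) (\<lambda>\<omega> t. W t \<omega>))"
      by (rule W.finite_measure_distr[OF mW])
  qed simp_all
qed

lemma brownian_AE_transfer:
  assumes W: "two_sided_brownian_motion M W" and B: "two_sided_brownian_motion N B"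
    and \<Phi>: "Measurable.pred (\<Pi>\<^sub>M t\<in>UNIV. borel) \<Phi>" and AE: "AE \<omega> in M. \<Phi> (\<lambda>t. W t \<omega>)"
  shows "AE \<omega> in N. \<Phi> (\<lambda>t. B t \<omega>)"
proof -
  have \<Phi>': "{w \<in> space (\<Pi>\<^sub>M t\<in>UNIV. borel). \<Phi> w} \<in> sets (\<Pi>\<^sub>M t\<in>UNIV. borel)"
    using \<Phi> by (simp add: pred_def)
  note iff = AE_distr_iff[OF two_sided_brownian_motion.measurable_path \<Phi>']
  have "AE w in distr M (\<Pi>\<^sub>M t\<in>UNIV. borel) (\<lambda>\<omega> t. W t \<omega>). \<Phi> w"
    unfolding iff[OF W] by (rule AE)
  then show ?thesis
    unfolding brownian_path_law_unique[OF W B] iff[OF B] .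
qed

lemma brownian_measure_transfer:
  assumes W: "two_sided_brownian_motion M W" and B: "two_sided_brownian_motion N B"
    and \<Phi>: "Measurable.pred (\<Pi>\<^sub>M t\<in>UNIV. borel) \<Phi>"
  shows "measure M {\<omega> \<in> space M. \<Phi> (\<lambda>t. W t \<omega>)} = measure N {\<omega> \<in> space N. \<Phi> (\<lambda>t. B t \<omega>)}"
proof -
  have \<Phi>': "{w \<in> space (\<Pi>\<^sub>M t\<in>UNIV. borel). \<Phi> w} \<in> sets (\<Pi>\<^sub>M t\<in>UNIV. borel)"
    using \<Phi> by (simp add: pred_def)
  have *: "measure (distr M' (\<Pi>\<^sub>M t\<in>UNIV. borel) (\<lambda>\<omega> t. X t \<omega>)) {w \<in> space (\<Pi>\<^sub>M t\<in>UNIV. borel). \<Phi> w}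
      = measure M' {\<omega> \<in> space M'. \<Phi> (\<lambda>t. X t \<omega>)}"
    if X: "two_sided_brownian_motion M' X" for M' :: "'c measure" and X
    unfolding measure_distr[OF two_sided_brownian_motion.measurable_path[OF X] \<Phi>']
    by (rule arg_cong[where f = "measure M'"]) (auto simp: space_PiM)
  show ?thesis using *[OF W] *[OF B] brownian_path_law_unique[OF W B] by simp
qed

section \<open>Minimizers of continuous functions\<close>

text \<open>The factor \<open>\<delta>\<close> is left open so that the class is closed under
  subtracting linear functions, which costs part of the curvature, and under rescaling.\<close>

definition quadratic_lower_bound :: "(real \<Rightarrow> real) \<Rightarrow> bool" where
  "quadratic_lower_bound Y \<longleftrightarrow> (\<exists>\<delta>>0. \<exists>C. \<forall>t. \<delta> * t\<^sup>2 - C \<le> Y t)"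

lemma quadratic_lower_bound_diff_linear:
  assumes "quadratic_lower_bound Y"
  shows "quadratic_lower_bound (\<lambda>t. Y t - a * t)"
proof -
  obtain \<delta> C where \<delta>: "0 < \<delta>" and Y: "\<And>t. \<delta> * t\<^sup>2 - C \<le> Y t"
    using assms unfolding quadratic_lower_bound_def by blast
  have "\<delta> / 2 * t\<^sup>2 - (C + a\<^sup>2 / (2 * \<delta>)) \<le> Y t - a * t" for t
  proof -
    have "0 \<le> \<delta> / 2 * (t - a / \<delta>)\<^sup>2" using \<delta> by simp
    also have "\<dots> = \<delta> / 2 * t\<^sup>2 - a * t + a\<^sup>2 / (2 * \<delta>)"
      using \<delta> by (simp add: power2_eq_square field_simps)
    finally have "a * t \<le> \<delta> / 2 * t\<^sup>2 + a\<^sup>2 / (2 * \<delta>)" by linarith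
    moreover have "\<delta> * t\<^sup>2 = \<delta> / 2 * t\<^sup>2 + \<delta> / 2 * t\<^sup>2" by simp
    ultimately show ?thesis using Y[of t] by linarith
  qed
  then show ?thesis unfolding quadratic_lower_bound_def using \<delta> half_gt_zero by blast
qed

lemma quadratic_lower_bound_affine:
  assumes eq: "\<And>s. Y (h - l * s) = k * V s + c" and k: "0 < k" and l: "0 < l"
    and V: "quadratic_lower_bound V"
  shows "quadratic_lower_bound Y"
proof -
  obtain \<delta> C where \<delta>: "0 < \<delta>" and C: "\<And>s. \<delta> * s\<^sup>2 - C \<le> V s"
    using V unfolding quadratic_lower_bound_def by blast
  define e where "e = k * \<delta> / l\<^sup>2"
  have e: "0 < e" using k l \<delta> by (simp add: e_def)
  have "e / 2 * u\<^sup>2 - (e * h\<^sup>2 + k * C - c) \<le> Y u" for u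
  proof -
    have "k * (\<delta> * ((h - u) / l)\<^sup>2 - C) \<le> k * V ((h - u) / l)"
      using C[of "(h - u) / l"] k by (intro mult_left_mono) auto
    moreover have "k * (\<delta> * ((h - u) / l)\<^sup>2 - C) = e * (h - u)\<^sup>2 - k * C"
      by (simp add: e_def power_divide right_diff_distrib)
    moreover have "Y u = k * V ((h - u) / l) + c" using eq[of "(h - u) / l"] l by simp
    moreover have "e * (u\<^sup>2 / 2 - h\<^sup>2) \<le> e * (h - u)\<^sup>2"
    proof (intro mult_left_mono)
      have "0 \<le> (u - 2 * h)\<^sup>2" by simp
      then show "u\<^sup>2 / 2 - h\<^sup>2 \<le> (h - u)\<^sup>2" by (simp add: power2_eq_square algebra_simps)
    qed (use e in simp)
    moreover have "e * (u\<^sup>2 / 2 - h\<^sup>2) = e / 2 * u\<^sup>2 - e * h\<^sup>2"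
      by (simp add: right_diff_distrib)
    ultimately show ?thesis by linarith
  qed
  with e show ?thesis unfolding quadratic_lower_bound_def by (meson half_gt_zero)
qed

lemma quadratic_lower_bound_attains_min:
  assumes Y: "continuous_on UNIV Y" and q: "quadratic_lower_bound Y"
  shows "\<exists>t. \<forall>u. Y t \<le> Y u"
proof -
  obtain \<delta> C where \<delta>: "0 < \<delta>" and C: "\<And>t. \<delta> * t\<^sup>2 - C \<le> Y t"
    using q unfolding quadratic_lower_bound_def by blast
  \<comment> \<open>As \<open>R \<ge> 1\<close>, \<open>\<bar>u\<bar> > R\<close> implies
    \<open>u\<^sup>2 \<ge> R\<close> and hence \<open>\<delta> * u\<^sup>2 - C \<ge> Y 0\<close>;
    this choice avoids a square root.\<close>
  define R where "R = (\<bar>Y 0\<bar> + \<bar>C\<bar>) / \<delta> + 1"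
  have R: "1 \<le> R" using \<delta> by (simp add: R_def)
  have far: "Y 0 \<le> Y u" if "R < \<bar>u\<bar>" for u
  proof -
    have "R \<le> \<bar>u\<bar> * 1" using that by simp
    also have "\<dots> \<le> \<bar>u\<bar> * \<bar>u\<bar>" using that R by (intro mult_left_mono) auto
    finally have "R \<le> u\<^sup>2" by (simp add: power2_eq_square)
    then have "\<delta> * R \<le> \<delta> * u\<^sup>2" using \<delta> by simp
    moreover have "\<delta> * R = \<bar>Y 0\<bar> + \<bar>C\<bar> + \<delta>" using \<delta> by (simp add: R_def field_simps)
    ultimately show ?thesis using C[of u] \<delta> by linarith
  qed
  have "\<exists>t\<in>{-R..R}. \<forall>u\<in>{-R..R}. Y t \<le> Y u"
    by (intro continuous_attains_inf continuous_on_subset[OF Y]) (use R in auto)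
  then obtain t where t: "t \<in> {-R..R}" "\<And>u. u \<in> {-R..R} \<Longrightarrow> Y t \<le> Y u" by blast
  have "Y t \<le> Y u" for u
  proof (cases "u \<in> {-R..R}")
    case False
    then have "Y 0 \<le> Y u" by (intro far) auto
    moreover have "Y t \<le> Y 0" using R by (intro t) auto
    ultimately show ?thesis by linarith
  qed (rule t)
  then show ?thesis by blast
qed

text \<open>The horizontal line at height \<open>m\<close> can be turned a little about
  \<open>(\<tau>, m)\<close>: to the left it goes down, on a compact interval to the right there is
  a positive gap, and beyond that interval \<open>Y\<close> outgrows every line.\<close>

lemma line_below_right:
  assumes Y: "continuous_on UNIV Y" and q: "quadratic_lower_bound Y"
    and m: "\<And>u. m \<le> Y u" and gt: "\<And>u. \<tau> \<le> u \<Longrightarrow> m < Y u"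
  shows "\<exists>\<epsilon>>0. \<forall>u. m + \<epsilon> * (u - \<tau>) \<le> Y u"
proof -
  have "continuous_on UNIV (\<lambda>t. Y t - 1 * t)" by (intro continuous_intros Y)
  then obtain t0 where t0: "\<And>u. Y t0 - t0 \<le> Y u - u"
    using quadratic_lower_bound_attains_min[OF _ quadratic_lower_bound_diff_linear[OF q]]
    by (metis mult_1)
  define K where "K = Y t0 - t0"
  \<comment> \<open>Solved from \<open>m + (u - \<tau>) / 2 \<le> K + u\<close>: beyond
    \<open>R\<close> the bound \<open>K + u \<le> Y u\<close> beats every line through
    \<open>(\<tau>, m)\<close> of slope at most 1/2.\<close>
  define R where "R = max (\<tau> + 1) (2 * m - \<tau> - 2 * K)"
  have "\<exists>t\<in>{\<tau>..R}. \<forall>u\<in>{\<tau>..R}. Y t \<le> Y u"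
    by (intro continuous_attains_inf continuous_on_subset[OF Y]) (auto simp: R_def)
  then obtain t1 where t1: "t1 \<in> {\<tau>..R}" "\<And>u. u \<in> {\<tau>..R} \<Longrightarrow> Y t1 \<le> Y u" by blast
  define \<epsilon> where "\<epsilon> = min (1 / 2) ((Y t1 - m) / (R - \<tau>))"
  have pos: "0 < Y t1 - m" "0 < R - \<tau>" using gt[of t1] t1(1) by (auto simp: R_def)
  have \<epsilon>: "0 < \<epsilon>" "\<epsilon> \<le> 1 / 2" "\<epsilon> * (R - \<tau>) \<le> Y t1 - m"
  proof -
    show "0 < \<epsilon>" using pos by (simp add: \<epsilon>_def)
    show "\<epsilon> \<le> 1 / 2" unfolding \<epsilon>_def by (rule min.cobounded1)
    have "\<epsilon> \<le> (Y t1 - m) / (R - \<tau>)" unfolding \<epsilon>_def by (rule min.cobounded2)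
    then show "\<epsilon> * (R - \<tau>) \<le> Y t1 - m" using pos(2) by (simp only: pos_le_divide_eq)
  qed
  have "m + \<epsilon> * (u - \<tau>) \<le> Y u" for u
  proof -
    consider "u \<le> \<tau>" | "\<tau> \<le> u" "u \<le> R" | "R < u" by linarith
    then show ?thesis
    proof cases
      case 1
      then have "\<epsilon> * (u - \<tau>) \<le> 0" using \<epsilon> by (simp add: mult_le_0_iff)
      then show ?thesis using m[of u] by linarith
    next
      case 2
      then have "\<epsilon> * (u - \<tau>) \<le> \<epsilon> * (R - \<tau>)" using \<epsilon> by (intro mult_left_mono) auto
      then show ?thesis using \<epsilon>(3) t1(2)[of u] 2 by auto
    next
      case 3
      then have "\<epsilon> * (u - \<tau>) \<le> 1 / 2 * (u - \<tau>)"
        using \<epsilon> by (intro mult_right_mono) (auto simp: R_def)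
      moreover have "2 * m - \<tau> - 2 * K < u" using 3 by (simp add: R_def)
      moreover have "K \<le> Y u - u" using t0 by (simp add: K_def)
      ultimately show ?thesis by argo
    qed
  qed
  with \<epsilon>(1) show ?thesis by blast
qed

lemma line_below_left:
  assumes Y: "continuous_on UNIV Y" and q: "quadratic_lower_bound Y"
    and m: "\<And>u. m \<le> Y u" and gt: "\<And>u. u \<le> \<tau> \<Longrightarrow> m < Y u"
  shows "\<exists>\<epsilon>>0. \<forall>u. m - \<epsilon> * (u - \<tau>) \<le> Y u"
proof -
  have "quadratic_lower_bound (\<lambda>u. Y (- u))"
    using q unfolding quadratic_lower_bound_def by (metis power2_minus)
  moreover have "continuous_on UNIV (\<lambda>u. Y (- u))"
    by (intro continuous_on_compose2[OF Y] continuous_intros) auto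
  ultimately obtain \<epsilon> where \<epsilon>: "0 < \<epsilon>" "\<And>u. m + \<epsilon> * (u - - \<tau>) \<le> Y (- u)"
    using line_below_right[of "\<lambda>u. Y (- u)" m "- \<tau>"] m gt by auto
  have "m - \<epsilon> * (u - \<tau>) \<le> Y u" for u using \<epsilon>(2)[of "- u"] by (simp add: algebra_simps)
  with \<epsilon>(1) show ?thesis by blast
qed

section \<open>Uniqueness of the minimizer for all but countably many slopes\<close>

lemma minimizers_mono_slope:
  fixes Y :: "real \<Rightarrow> real"
  assumes "a < b" "Y s - a * s \<le> Y t - a * t" "Y t - b * t \<le> Y s - b * s"
  shows "s \<le> t"
proof -
  have "(b - a) * s \<le> (b - a) * t" using assms by (simp add: algebra_simps)
  then show ?thesis using assms(1) by simp
qed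

text \<open>By \<open>minimizers_mono_slope\<close>, the spans of the minimizers for two different
  slopes overlap in at most an endpoint. A slope with several minimizers has a span with nonempty
  interior, and a rational number inside identifies the slope.\<close>

lemma countable_nonunique_minimizers:
  assumes Y: "continuous_on UNIV Y" and q: "quadratic_lower_bound Y"
  shows "countable {a. \<not> (\<exists>!t. \<forall>u. Y t - a * t \<le> Y u - a * u)}" (is "countable ?N")
proof -
  define P where "P a r \<longleftrightarrow> r \<in> \<rat> \<and> (\<exists>s t. s < r \<and> r < t \<and>
    (\<forall>u. Y s - a * s \<le> Y u - a * u) \<and> (\<forall>u. Y t - a * t \<le> Y u - a * u))" for a r :: real
  have ex: "\<exists>r. P a r" if a: "a \<in> ?N" for a
  proof -
    have "continuous_on UNIV (\<lambda>t. Y t - a * t)" by (intro continuous_intros Y)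
    then obtain t1 where t1: "\<forall>u. Y t1 - a * t1 \<le> Y u - a * u"
      using quadratic_lower_bound_attains_min[OF _ quadratic_lower_bound_diff_linear[OF q]] by blast
    then obtain t2 where t2: "\<forall>u. Y t2 - a * t2 \<le> Y u - a * u" "t2 \<noteq> t1"
      using a unfolding mem_Collect_eq by blast
    obtain s t where st: "s < t" "\<forall>u. Y s - a * s \<le> Y u - a * u" "\<forall>u. Y t - a * t \<le> Y u - a * u"
      using t1 t2 by (cases "t1 < t2") (blast, metis linorder_neqE)
    obtain r where "r \<in> \<rat>" "s < r" "r < t" using Rats_dense_in_real[OF st(1)] by blast
    then show ?thesis using st unfolding P_def by blast
  qed
  define r where "r a = (SOME r. P a r)" for a
  have r: "P a (r a)" if "a \<in> ?N" for a using someI_ex[OF ex[OF that]] unfolding r_def .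
  have less: "r a < r b" if ab: "a \<in> ?N" "b \<in> ?N" "a < b" for a b
  proof -
    obtain t where t: "r a < t" "\<forall>u. Y t - a * t \<le> Y u - a * u"
      using r[OF ab(1)] unfolding P_def by blast
    obtain s where s: "s < r b" "\<forall>u. Y s - b * s \<le> Y u - b * u"
      using r[OF ab(2)] unfolding P_def by blast
    have "t \<le> s"
      by (rule minimizers_mono_slope[OF ab(3) t(2)[rule_format] s(2)[rule_format]])
    then show ?thesis using t s by linarith
  qed
  have "inj_on r ?N"
    by (rule linorder_inj_onI') (rule less_imp_neq[OF less])
  moreover have "r ` ?N \<subseteq> \<rat>" using r unfolding P_def by blast
  then have "countable (r ` ?N)" using countable_rat countable_subset by blast
  ultimately show ?thesis by (rule countable_image_inj_on[rotated])
qed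

text \<open>For continuous \<open>Y\<close> the following conditions, which involve only countably many values of
  \<open>Y\<close>, express that \<open>[p, q]\<close> contains a global minimizer, that there is exactly one global
  minimizer, and that this minimizer (or the default value \<open>0\<close>) is at most \<open>z\<close>.\<close>

definition has_min_in :: "(real \<Rightarrow> real) \<Rightarrow> real \<Rightarrow> real \<Rightarrow> bool" where
  "has_min_in Y p q \<longleftrightarrow> (\<forall>r\<in>\<rat>. \<forall>n::nat. \<exists>s\<in>\<rat>. p \<le> s \<and> s \<le> q \<and> Y s < Y r + 1 / real (Suc n))"

definition unique_min :: "(real \<Rightarrow> real) \<Rightarrow> bool" where
  "unique_min Y \<longleftrightarrow> (\<exists>n::nat. has_min_in Y (- real (Suc n)) (real (Suc n))) \<and>
     \<not> (\<exists>p\<in>\<rat>. \<exists>q\<in>\<rat>. \<exists>n::nat. - real n < p \<and> p < q \<and> q < real n \<and>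
       has_min_in Y (- real n) p \<and> has_min_in Y q (real n))"

definition min_le :: "real \<Rightarrow> (real \<Rightarrow> real) \<Rightarrow> bool" where
  "min_le z Y \<longleftrightarrow> (if unique_min Y then \<exists>n::nat. - real n < z \<and> has_min_in Y (- real n) z else 0 \<le> z)"

text \<open>If \<open>[p, q]\<close> contains near-minimizers for every tolerance, the minimum over
  this compact interval is a lower bound at all rationals, hence everywhere. Conversely the
  rationals of \<open>[p, q]\<close> accumulate at a minimizer because \<open>p < q\<close>; a
  single irrational point would contain none.\<close>

lemma has_min_in_iff:
  assumes Y: "continuous_on UNIV Y" and "p < q"
  shows "has_min_in Y p q \<longleftrightarrow> (\<exists>t\<in>{p..q}. \<forall>u. Y t \<le> Y u)"
proof
  assume min: "has_min_in Y p q"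
  have "\<exists>t\<in>{p..q}. \<forall>u\<in>{p..q}. Y t \<le> Y u"
    by (intro continuous_attains_inf continuous_on_subset[OF Y]) (use \<open>p < q\<close> in auto)
  then obtain t where t: "t \<in> {p..q}" "\<And>u. u \<in> {p..q} \<Longrightarrow> Y t \<le> Y u" by blast
  have rat: "0 \<le> Y r - Y t" if r: "r \<in> \<rat>" for r
  proof (rule field_le_epsilon)
    fix e :: real assume "0 < e"
    then obtain n where n: "1 / real (Suc n) < e" using nat_approx_posE by blast
    obtain s where "s \<in> {p..q}" "Y s < Y r + 1 / real (Suc n)"
      using min r unfolding has_min_in_def by (metis atLeastAtMost_iff)
    then show "0 \<le> Y r - Y t + e" using t(2)[of s] n by linarith
  qed
  have "continuous_on (closure \<rat>) (\<lambda>r. Y r - Y t)"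
    by (intro continuous_intros continuous_on_subset[OF Y]) simp
  then have "0 \<le> Y u - Y t" for u
    using continuous_ge_on_closure[of \<rat> "\<lambda>r. Y r - Y t" u 0] rat by (simp add: Rats_closure_real)
  then show "\<exists>t\<in>{p..q}. \<forall>u. Y t \<le> Y u" using t(1) by (metis diff_ge_0_iff_ge)
next
  assume "\<exists>t\<in>{p..q}. \<forall>u. Y t \<le> Y u"
  then obtain t where t: "t \<in> {p..q}" "\<And>u. Y t \<le> Y u" by blast
  show "has_min_in Y p q"
    unfolding has_min_in_def
  proof (intro ballI allI)
    fix r :: real and n :: nat
    have "isCont Y t" using Y by (simp add: continuous_on_eq_continuous_at)
    then obtain d where d: "0 < d" "\<And>s. \<bar>s - t\<bar> < d \<Longrightarrow> \<bar>Y s - Y t\<bar> < 1 / real (Suc n)"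
      unfolding continuous_at_eps_delta dist_real_def
      by (metis of_nat_0_less_iff zero_less_Suc zero_less_divide_1_iff)
    have "max p (t - d) < min q (t + d)" using t(1) d(1) \<open>p < q\<close> by auto
    then obtain s where s: "s \<in> \<rat>" "max p (t - d) < s" "s < min q (t + d)"
      using Rats_dense_in_real by blast
    then have "\<bar>Y s - Y t\<bar> < 1 / real (Suc n)" by (intro d) auto
    then have "Y s < Y r + 1 / real (Suc n)" using t(2)[of r] by linarith
    then show "\<exists>s\<in>\<rat>. p \<le> s \<and> s \<le> q \<and> Y s < Y r + 1 / real (Suc n)"
      using s by (intro bexI[of _ s]) auto
  qed
qed

text \<open>Two minimizers are separated by rationals \<open>p < q\<close>, with one in an interval
  left of \<open>p\<close> and the other in one right of \<open>q\<close>. All intervals must be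
  nondegenerate, hence \<open>Suc n\<close> and the strict inequalities in
  \<open>unique_min\<close>.\<close>

lemma unique_min_iff:
  assumes Y: "continuous_on UNIV Y"
  shows "unique_min Y \<longleftrightarrow> (\<exists>!t. \<forall>u. Y t \<le> Y u)"
proof -
  have "(\<exists>n::nat. has_min_in Y (- real (Suc n)) (real (Suc n))) \<longleftrightarrow> (\<exists>t. \<forall>u. Y t \<le> Y u)"
  proof -
    have "\<exists>n. t \<in> {- real (Suc n)..real (Suc n)}" for t
    proof -
      obtain n where "\<bar>t\<bar> \<le> real n" using real_arch_simple by blast
      then show ?thesis by (intro exI[of _ n]) auto
    qed
    then show ?thesis by (subst has_min_in_iff[OF Y]) (simp, blast)
  qed
  moreover have "(\<exists>p\<in>\<rat>. \<exists>q\<in>\<rat>. \<exists>n::nat. - real n < p \<and> p < q \<and> q < real n \<and>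
       has_min_in Y (- real n) p \<and> has_min_in Y q (real n)) \<longleftrightarrow>
     (\<exists>s t. s < t \<and> (\<forall>u. Y s \<le> Y u) \<and> (\<forall>u. Y t \<le> Y u))" (is "?L \<longleftrightarrow> ?R")
  proof
    assume ?L
    then obtain p q :: real and n :: nat where pq: "- real n < p" "p < q" "q < real n"
      "has_min_in Y (- real n) p" "has_min_in Y q (real n)" by blast
    obtain s where s: "s \<in> {- real n..p}" "\<forall>u. Y s \<le> Y u"
      using pq(4) unfolding has_min_in_iff[OF Y pq(1)] by blast
    obtain t where t: "t \<in> {q..real n}" "\<forall>u. Y t \<le> Y u"
      using pq(5) unfolding has_min_in_iff[OF Y pq(3)] by blast
    have "s < t" using s(1) t(1) pq(2) by simp
    with s(2) t(2) show ?R by blast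
  next
    assume ?R
    then obtain s t where st: "s < t" "\<forall>u. Y s \<le> Y u" "\<forall>u. Y t \<le> Y u" by blast
    obtain p where p: "p \<in> \<rat>" "s < p" "p < t" using Rats_dense_in_real[OF st(1)] by blast
    obtain q where q: "q \<in> \<rat>" "p < q" "q < t" using Rats_dense_in_real[OF p(3)] by blast
    obtain n where "\<bar>s\<bar> + \<bar>t\<bar> + 1 \<le> real n" using real_arch_simple by blast
    then have n: "- real n < s" "t < real n" by auto
    have pn: "- real n < p" and qn: "q < real n" using n p q by auto
    have "has_min_in Y (- real n) p"
      unfolding has_min_in_iff[OF Y pn] using st(2) n p by (intro bexI[of _ s]) auto
    moreover have "has_min_in Y q (real n)"
      unfolding has_min_in_iff[OF Y qn] using st(3) n q by (intro bexI[of _ t]) auto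
    ultimately show ?L using pn qn p(1) q(1,2) by blast
  qed
  moreover have ex1: "(\<exists>!t. m t) \<longleftrightarrow> (\<exists>t. m t) \<and> \<not> (\<exists>s t. s < t \<and> m s \<and> m t)"
    for m :: "real \<Rightarrow> bool"
    by (metis linorder_neqE less_irrefl)
  ultimately show ?thesis
    unfolding unique_min_def ex1[of "\<lambda>t. \<forall>u. Y t \<le> Y u"] by (simp only:)
qed

text \<open>Makes the event depend on countably many values of the path; measurability of the
  minimizer and the comparison of its laws both rest on this form.\<close>

lemma chernoff_minimizer_le_iff:
  assumes w: "continuous_on UNIV w"
  shows "chernoff_minimizer w \<le> z \<longleftrightarrow> min_le z (\<lambda>t. w t + t\<^sup>2)"
proof -
  let ?Y = "\<lambda>t. w t + t\<^sup>2"
  have Y: "continuous_on UNIV ?Y" by (intro continuous_intros w)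
  have is_min: "is_chernoff_minimizer w t \<longleftrightarrow> (\<forall>u. ?Y t \<le> ?Y u)" for t
    by (simp add: is_chernoff_minimizer_def is_arg_min_linorder)
  show ?thesis
  proof (cases "unique_min ?Y")
    case True
    then have ex1: "\<exists>!t. is_chernoff_minimizer w t" using unique_min_iff[OF Y] is_min by simp
    then obtain T where T: "is_chernoff_minimizer w T" "\<And>t. is_chernoff_minimizer w t \<Longrightarrow> t = T" by blast
    have "chernoff_minimizer w = T"
      unfolding chernoff_minimizer_def if_P[OF ex1] using T by (rule the_equality)
    moreover have "T \<le> z \<longleftrightarrow> (\<exists>n::nat. - real n < z \<and> has_min_in ?Y (- real n) z)"
    proof
      assume "T \<le> z"
      \<comment> \<open>Large enough for \<open>[- n, z]\<close> to be nondegenerate and to contain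
        \<open>T\<close>.\<close>
      obtain n where "\<bar>T\<bar> + \<bar>z\<bar> + 1 \<le> real n" using real_arch_simple by blast
      then have n: "- real n < z" "- real n \<le> T" by linarith+
      have "has_min_in ?Y (- real n) z"
        unfolding has_min_in_iff[OF Y n(1)]
      proof
        show "T \<in> {- real n..z}" using n(2) \<open>T \<le> z\<close> by simp
        show "\<forall>u. ?Y T \<le> ?Y u" using T(1) unfolding is_min .
      qed
      then show "\<exists>n::nat. - real n < z \<and> has_min_in ?Y (- real n) z" using n by blast
    next
      assume "\<exists>n::nat. - real n < z \<and> has_min_in ?Y (- real n) z"
      then obtain n :: nat where n: "- real n < z" "has_min_in ?Y (- real n) z" by blast
      from n(2) obtain t where t: "t \<in> {- real n..z}" "\<forall>u. ?Y t \<le> ?Y u"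
        unfolding has_min_in_iff[OF Y n(1)] by blast
      then have "t = T" unfolding is_min[symmetric] by (intro T(2))
      then show "T \<le> z" using t(1) by simp
    qed
    ultimately show ?thesis using True by (simp add: min_le_def)
  next
    case False
    then have "\<not> (\<exists>!t. is_chernoff_minimizer w t)" using unique_min_iff[OF Y] is_min by simp
    then have "chernoff_minimizer w = 0" unfolding chernoff_minimizer_def by (rule if_not_P)
    then show ?thesis using False by (simp add: min_le_def)
  qed
qed

lemma measurable_has_min_in:
  assumes [measurable]: "\<And>s. (\<lambda>x. Y x s) \<in> borel_measurable N"
  shows "Measurable.pred N (\<lambda>x. has_min_in (Y x) p q)"
  unfolding has_min_in_def using countable_rat by measurable

lemma measurable_unique_min:
  assumes "\<And>s. (\<lambda>x. Y x s) \<in> borel_measurable N"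
  shows "Measurable.pred N (\<lambda>x. unique_min (Y x))"
proof -
  note [measurable] = measurable_has_min_in[OF assms]
  show ?thesis unfolding unique_min_def using countable_rat by measurable
qed

lemma measurable_min_le:
  assumes "\<And>s. (\<lambda>x. Y x s) \<in> borel_measurable N"
  shows "Measurable.pred N (\<lambda>x. min_le z (Y x))"
proof -
  note [measurable] = measurable_has_min_in[OF assms] measurable_unique_min[OF assms]
  show ?thesis unfolding min_le_def by measurable
qed

section \<open>Minimizers under a reflected affine change of variable\<close>

lemma minimizer_affine_iff:
  fixes Y V :: "real \<Rightarrow> real"
  assumes eq: "\<And>s. Y (h - l * s) = k * V s + c" and "0 < k" "0 < l"
  shows "(\<forall>u. Y (h - l * s) \<le> Y u) \<longleftrightarrow> (\<forall>u. V s \<le> V u)"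
proof -
  have "Y u = k * V ((h - u) / l) + c" for u using eq[of "(h - u) / l"] assms by simp
  moreover have "(\<forall>u. V s \<le> V ((h - u) / l)) \<longleftrightarrow> (\<forall>u. V s \<le> V u)"
  proof (intro iffI allI)
    fix u assume "\<forall>u. V s \<le> V ((h - u) / l)"
    from this[rule_format, of "h - l * u"] show "V s \<le> V u" using assms by simp
  qed simp
  ultimately show ?thesis using assms by (simp add: eq)
qed

lemma unique_minimizer_affine_iff:
  fixes Y V :: "real \<Rightarrow> real"
  assumes eq: "\<And>s. Y (h - l * s) = k * V s + c" and "0 < k" "0 < l"
  shows "(\<exists>!t. \<forall>u. Y t \<le> Y u) \<longleftrightarrow> (\<exists>!s. \<forall>u. V s \<le> V u)"
proof -
  have *: "(\<forall>u. Y t \<le> Y u) \<longleftrightarrow> (\<forall>u. V ((h - t) / l) \<le> V u)" for t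
    using minimizer_affine_iff[where Y = Y and V = V and h = h and l = l and k = k and c = c,
        OF assms, of "(h - t) / l"] assms(2,3) by simp
  have inverses: "(h - (h - l * s)) / l = s" "h - l * ((h - t) / l) = t" for s t
    using \<open>0 < l\<close> by simp_all
  have "(\<exists>!t. A ((h - t) / l)) \<longleftrightarrow> (\<exists>!s. A s)" for A
  proof
    assume "\<exists>!t. A ((h - t) / l)"
    then obtain t where t: "A ((h - t) / l)" "\<And>t'. A ((h - t') / l) \<Longrightarrow> t' = t" by blast
    show "\<exists>!s. A s"
    proof (rule ex1I[of _ "(h - t) / l"])
      fix s assume "A s"
      then have "h - l * s = t" using t(2)[of "h - l * s"] by (simp only: inverses)
      then show "s = (h - t) / l" using inverses(1)[of s] by simp
    qed (rule t(1))
  next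
    assume "\<exists>!s. A s"
    then obtain s where s: "A s" "\<And>s'. A s' \<Longrightarrow> s' = s" by blast
    show "\<exists>!t. A ((h - t) / l)"
    proof (rule ex1I[of _ "h - l * s"])
      show "A ((h - (h - l * s)) / l)" unfolding inverses by (rule s(1))
      fix t assume "A ((h - t) / l)"
      then have "(h - t) / l = s" by (rule s(2))
      then show "t = h - l * s" using inverses(2)[of t] by simp
    qed
  qed
  then show ?thesis unfolding * .
qed

section \<open>Chernoff's distribution\<close>

context two_sided_brownian_motion
begin

text \<open>Growth on the negative half line is growth of the reflected motion on the positive one.
  Of the curvature 1, one half remains.\<close>

lemma AE_quadratic_lower_bound: "AE \<omega> in M. quadratic_lower_bound (\<lambda>t. W t \<omega> + t\<^sup>2)"
proof -
  interpret R: two_sided_brownian_motion M "\<lambda>s \<omega>. (W (0 - 1 * s) \<omega> - W 0 \<omega>) / sqrt 1"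
    by (rule reversed_brownian_motion) simp
  from AE_growth_nonneg R.AE_growth_nonneg AE_space show ?thesis
  proof eventually_elim
    case (elim \<omega>)
    then obtain C1 C2 where C: "\<And>t. 0 \<le> t \<Longrightarrow> \<bar>W t \<omega>\<bar> \<le> t\<^sup>2 / 2 + C1"
      "\<And>t. 0 \<le> t \<Longrightarrow> \<bar>W (- t) \<omega>\<bar> \<le> t\<^sup>2 / 2 + C2"
      using W_zero[of \<omega>] by auto
    have "1 / 2 * t\<^sup>2 - max C1 C2 \<le> W t \<omega> + t\<^sup>2" for t
      using C(1)[of t] C(2)[of "- t"] by (cases "0 \<le> t") auto
    then show ?case
      unfolding quadratic_lower_bound_def
      by (intro exI[of _ "1 / 2 :: real"] conjI exI[of _ "max C1 C2"]) auto
  qed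
qed

text \<open>
  For each path the set of slopes \<open>a\<close> for which \<open>W t + t\<^sup>2 - a t\<close> has several
  minimizers is countable, so by Fubini's theorem the minimizer is almost surely unique for some
  slope \<open>a\<close>. Completing the square and shifting time turns this slope into \<open>0\<close>.
\<close>

lemma AE_unique_min: "AE \<omega> in M. unique_min (\<lambda>t. W t \<omega> + t\<^sup>2)"
proof -
  note [measurable] = measurable_W
  define P where "P a \<omega> \<longleftrightarrow> unique_min (\<lambda>t. W t \<omega> + t\<^sup>2 - a * t)" for a \<omega>
  have cont: "continuous_on UNIV (\<lambda>t. W t \<omega> + t\<^sup>2)" if "\<omega> \<in> space M" for \<omega>
    by (intro continuous_intros continuous_paths that)
  have cont': "continuous_on UNIV (\<lambda>t. W t \<omega> + t\<^sup>2 - a * t)" if "\<omega> \<in> space M" for \<omega> a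
    by (intro continuous_intros continuous_paths that)
  interpret pair_sigma_finite lborel M ..
  have "Measurable.pred (lborel \<Otimes>\<^sub>M M) (\<lambda>x. P (fst x) (snd x))"
    unfolding P_def by (intro measurable_unique_min) measurable
  then have meas: "{x \<in> space (lborel \<Otimes>\<^sub>M M). P (fst x) (snd x)} \<in> sets (lborel \<Otimes>\<^sub>M M)"
    by (simp add: pred_def)
  have "AE \<omega> in M. AE a in lborel. P a \<omega>"
    using AE_quadratic_lower_bound AE_space
  proof eventually_elim
    case (elim \<omega>)
    let ?Y = "\<lambda>t. W t \<omega> + t\<^sup>2"
    have "AE a in lborel. a \<notin> {a. \<not> (\<exists>!t. \<forall>u. ?Y t - a * t \<le> ?Y u - a * u)}"
      by (intro AE_not_in countable_imp_null_set_lborel countable_nonunique_minimizers cont elim)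
    then show ?case
      unfolding P_def unique_min_iff[OF cont'[OF elim(2)]] by simp
  qed
  then have "AE a in lborel. AE \<omega> in M. P a \<omega>" unfolding AE_commute[OF meas] .
  \<comment> \<open>Lebesgue measure is not null, so a property of almost every \<open>a\<close>
    holds for at least one \<open>a\<close>.\<close>
  moreover have "ae_filter (lborel :: real measure) \<noteq> bot"
    by (simp add: ae_filter_eq_bot_iff)
  ultimately obtain a where a: "AE \<omega> in M. P a \<omega>" using eventually_happens' by blast
  \<comment> \<open>\<open>a / 2\<close> is the vertex of \<open>t\<^sup>2 - a * t\<close>.\<close>
  let ?V = "\<lambda>s \<omega>. (W (a / 2 - 1 * s) \<omega> - W (a / 2) \<omega>) / sqrt 1"
  have V: "two_sided_brownian_motion M ?V" by (rule reversed_brownian_motion) simp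
  interpret V: two_sided_brownian_motion M ?V by (rule V)
  have "AE \<omega> in M. unique_min (\<lambda>t. ?V t \<omega> + t\<^sup>2)"
    using a AE_space
  proof eventually_elim
    case (elim \<omega>)
    have cV: "continuous_on UNIV (\<lambda>t. ?V t \<omega> + t\<^sup>2)"
      by (intro continuous_intros V.continuous_paths elim)
    have "W (a / 2 - 1 * s) \<omega> + (a / 2 - 1 * s)\<^sup>2 - a * (a / 2 - 1 * s)
        = 1 * (?V s \<omega> + s\<^sup>2) + (W (a / 2) \<omega> - a\<^sup>2 / 4)" for s
      by (simp add: power2_eq_square algebra_simps)
    from unique_minimizer_affine_iff[where Y = "\<lambda>t. W t \<omega> + t\<^sup>2 - a * t", OF this] elim
    show ?case
      unfolding P_def unique_min_iff[OF cV] unique_min_iff[OF cont'[OF elim(2)]] by simp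
  qed
  \<comment> \<open>Uniqueness is now known for \<open>?V\<close>; it passes to \<open>W\<close>
    because both have the same law.\<close>
  moreover have "Measurable.pred (\<Pi>\<^sub>M t\<in>UNIV. borel) (\<lambda>w. unique_min (\<lambda>t. w t + t\<^sup>2))"
    by (intro measurable_unique_min) measurable
  ultimately show ?thesis
    by (intro brownian_AE_transfer[OF V two_sided_brownian_motion_axioms,
        where \<Phi> = "\<lambda>w. unique_min (\<lambda>t. w t + t\<^sup>2)"])
qed

lemma AE_unique_chernoff_minimizer: "AE \<omega> in M. \<exists>!t. is_chernoff_minimizer (\<lambda>s. W s \<omega>) t"
  using AE_unique_min AE_space
proof eventually_elim
  case (elim \<omega>)
  have "continuous_on UNIV (\<lambda>t. W t \<omega> + t\<^sup>2)"
    by (intro continuous_intros continuous_paths elim)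
  from unique_min_iff[OF this] elim(1) show ?case
    by (simp add: is_chernoff_minimizer_def is_arg_min_linorder)
qed

lemma chernoff_minimizer_measurable:
  "(\<lambda>\<omega>. chernoff_minimizer (\<lambda>t. W t \<omega>)) \<in> borel_measurable M"
  unfolding borel_measurable_iff_le
proof
  fix z
  note [measurable] = measurable_W
  have "{\<omega> \<in> space M. chernoff_minimizer (\<lambda>t. W t \<omega>) \<le> z}
      = {\<omega> \<in> space M. min_le z (\<lambda>t. W t \<omega> + t\<^sup>2)}"
    using chernoff_minimizer_le_iff[OF continuous_paths] by blast
  moreover have "Measurable.pred M (\<lambda>\<omega>. min_le z (\<lambda>t. W t \<omega> + t\<^sup>2))"
    by (intro measurable_min_le) measurable
  ultimately show "{\<omega> \<in> space M. chernoff_minimizer (\<lambda>t. W t \<omega>) \<le> z} \<in> sets M"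
    by (simp add: pred_def)
qed

end

lemma chernoff_minimizer_law_unique:
  assumes W: "two_sided_brownian_motion M W" and B: "two_sided_brownian_motion N B"
  shows "distr M borel (\<lambda>\<omega>. chernoff_minimizer (\<lambda>t. W t \<omega>))
    = distr N borel (\<lambda>\<omega>. chernoff_minimizer (\<lambda>t. B t \<omega>))"
proof (rule cdf_unique)
  note mW = two_sided_brownian_motion.chernoff_minimizer_measurable[OF W]
  note mB = two_sided_brownian_motion.chernoff_minimizer_measurable[OF B]
  show "real_distribution (distr M borel (\<lambda>\<omega>. chernoff_minimizer (\<lambda>t. W t \<omega>)))"
    using W mW by (intro prob_space.real_distribution_distr)
      (auto simp: two_sided_brownian_motion_def)
  show "real_distribution (distr N borel (\<lambda>\<omega>. chernoff_minimizer (\<lambda>t. B t \<omega>)))"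
    using B mB by (intro prob_space.real_distribution_distr)
      (auto simp: two_sided_brownian_motion_def)
  have *: "cdf (distr M' borel (\<lambda>\<omega>. chernoff_minimizer (\<lambda>t. X t \<omega>))) z
      = measure M' {\<omega> \<in> space M'. min_le z (\<lambda>t. X t \<omega> + t\<^sup>2)}"
    if X: "two_sided_brownian_motion M' X" for M' :: "'c measure" and X z
  proof -
    interpret X: two_sided_brownian_motion M' X by (rule X)
    have "cdf (distr M' borel (\<lambda>\<omega>. chernoff_minimizer (\<lambda>t. X t \<omega>))) z
        = measure M' {\<omega> \<in> space M'. chernoff_minimizer (\<lambda>t. X t \<omega>) \<le> z}"
      by (auto simp: cdf_def measure_distr[OF X.chernoff_minimizer_measurable]
          intro!: arg_cong[where f = "measure M'"])
    also have "{\<omega> \<in> space M'. chernoff_minimizer (\<lambda>t. X t \<omega>) \<le> z}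
        = {\<omega> \<in> space M'. min_le z (\<lambda>t. X t \<omega> + t\<^sup>2)}"
      using chernoff_minimizer_le_iff[OF X.continuous_paths] by blast
    finally show ?thesis .
  qed
  have "Measurable.pred (\<Pi>\<^sub>M t\<in>UNIV. borel) (\<lambda>w. min_le z (\<lambda>t. w t + t\<^sup>2))" for z
    by (intro measurable_min_le) measurable
  note transfer = brownian_measure_transfer[OF W B, where \<Phi> = "\<lambda>w. min_le z (\<lambda>t. w t + t\<^sup>2)" for z, OF this]
  show "cdf (distr M borel (\<lambda>\<omega>. chernoff_minimizer (\<lambda>t. W t \<omega>)))
      = cdf (distr N borel (\<lambda>\<omega>. chernoff_minimizer (\<lambda>t. B t \<omega>)))"
    unfolding fun_eq_iff *[OF W] *[OF B] using transfer by blast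
qed

section \<open>Slopes of the minorants and minimizers\<close>

text \<open>The line of slope \<open>a\<close> through \<open>(T, X T)\<close> touches
  \<open>X\<close> only there. Turning it slightly about its point over \<open>T / 2\<close>, which
  lies strictly between \<open>T\<close> and 0, keeps it below \<open>X\<close> and raises it at 0:
  \<open>b\<close> is the new height there, \<open>X T - a * T\<close> the old one.\<close>

lemma separating_line:
  assumes X: "continuous_on UNIV X" and q: "quadratic_lower_bound X"
    and T: "T \<noteq> 0" and min: "\<And>u. u \<noteq> T \<Longrightarrow> X T - a * T < X u - a * u"
  shows "\<exists>b s. (\<forall>u. b + s * u \<le> X u) \<and> X T < b + a * T"
proof -
  define Y where "Y u = X u - a * u" for u
  have Y: "continuous_on UNIV Y" "quadratic_lower_bound Y"
    unfolding Y_def by (intro continuous_intros X quadratic_lower_bound_diff_linear q)+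
  have le: "Y T \<le> Y u" for u using min[of u] by (cases "u = T") (auto simp: Y_def)
  show ?thesis
  proof (cases "T < 0")
    case True
    have "Y T < Y u" if "T / 2 \<le> u" for u
      unfolding Y_def by (rule min) (use that True in auto)
    then obtain \<epsilon> where \<epsilon>: "0 < \<epsilon>" "\<And>u. Y T + \<epsilon> * (u - T / 2) \<le> Y u"
      using line_below_right[OF Y le] by blast
    have "(Y T - \<epsilon> * (T / 2)) + (a + \<epsilon>) * u \<le> X u" for u
      using \<epsilon>(2)[of u] by (simp add: Y_def algebra_simps)
    moreover have "\<epsilon> * (T / 2) < 0" using \<epsilon>(1) True by (simp add: mult_pos_neg)
    then have "X T < (Y T - \<epsilon> * (T / 2)) + a * T" by (simp add: Y_def)
    ultimately show ?thesis by blast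
  next
    case False
    then have pos: "0 < T" using T by simp
    have "Y T < Y u" if "u \<le> T / 2" for u
      unfolding Y_def by (rule min) (use that pos in auto)
    then obtain \<epsilon> where \<epsilon>: "0 < \<epsilon>" "\<And>u. Y T - \<epsilon> * (u - T / 2) \<le> Y u"
      using line_below_left[OF Y le] by blast
    have "(Y T + \<epsilon> * (T / 2)) + (a - \<epsilon>) * u \<le> X u" for u
      using \<epsilon>(2)[of u] by (simp add: Y_def algebra_simps)
    moreover have "0 < \<epsilon> * (T / 2)" using \<epsilon>(1) pos by simp
    then have "X T < (Y T + \<epsilon> * (T / 2)) + a * T" by (simp add: Y_def)
    ultimately show ?thesis by blast
  qed
qed

lemma two_sided_unbounded_UNIV: "two_sided_unbounded UNIV"
  unfolding two_sided_unbounded_def by (simp add: lt_ex gt_ex)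

lemma two_sided_unbounded_Rats: "two_sided_unbounded \<rat>"
  unfolding two_sided_unbounded_def
  using Rats_no_bot_less Rats_no_top_le by (meson Rats_dense_in_real lt_ex gt_ex)

lemma two_sided_unbounded_grid:
  assumes "0 < c"
  shows "two_sided_unbounded (range (\<lambda>k::int. c * of_int k))"
  unfolding two_sided_unbounded_def
proof
  fix x
  have "c * of_int (\<lfloor>x / c\<rfloor> - 1) < x"
  proof -
    have "of_int (\<lfloor>x / c\<rfloor> - 1) < x / c" by linarith
    then show ?thesis using assms by (simp add: pos_less_divide_eq mult.commute)
  qed
  moreover have "x < c * of_int (\<lfloor>x / c\<rfloor> + 1)"
  proof -
    have "x / c < of_int (\<lfloor>x / c\<rfloor> + 1)" by linarith
    then have "x < of_int (\<lfloor>x / c\<rfloor> + 1) * c" using assms by (simp only: pos_divide_less_eq)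
    then show ?thesis by (simp only: mult.commute)
  qed
  ultimately show "(\<exists>p\<in>range (\<lambda>k::int. c * of_int k). p < x) \<and> (\<exists>q\<in>range (\<lambda>k::int. c * of_int k). x < q)"
    by blast
qed

lemma slope_process_eq:
  "slope_process \<alpha> \<beta> w h = left_deriv (gcm (graph_on UNIV (drift_process \<alpha> \<beta> w))) h"
  by (simp add: slope_process_def graph_on_def)

text \<open>On the grid, \<open>c\<^sup>2 k (1 + k) = t\<^sup>2 + c t\<close> with \<open>t = c k\<close>.\<close>

lemma grid_slope_zero_eq:
  "grid_slope_zero c \<alpha> \<beta> w = left_deriv (gcm (graph_on (range (\<lambda>k::int. c * of_int k))
     (\<lambda>t. drift_process \<alpha> \<beta> w t + \<beta> * c * t))) 0"
proof -
  have "range (grid_point c \<alpha> \<beta> w) = graph_on (range (\<lambda>k::int. c * of_int k))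
     (\<lambda>t. drift_process \<alpha> \<beta> w t + \<beta> * c * t)"
    unfolding graph_on_def image_image grid_point_def drift_process_def
    by (rule image_cong) (simp_all add: power2_eq_square algebra_simps)
  then show ?thesis by (simp add: grid_slope_zero_def)
qed

text \<open>The switching relation. For \<open>T < 0\<close> the turned line forces a slope above
  \<open>a\<close>; for \<open>T \<ge> 0\<close> the line of slope \<open>a\<close> itself touches
  at \<open>T\<close>, and \<open>T = 0\<close> falls on this side because the derivative is taken
  from the left.\<close>

lemma slope_process_le_iff:
  assumes X: "continuous_on UNIV (drift_process \<alpha> \<beta> w)"
    and q: "quadratic_lower_bound (drift_process \<alpha> \<beta> w)"
    and min: "\<And>u. u \<noteq> T \<Longrightarrow>
      drift_process \<alpha> \<beta> w T - a * T < drift_process \<alpha> \<beta> w u - a * u"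
  shows "slope_process \<alpha> \<beta> w 0 \<le> a \<longleftrightarrow> 0 \<le> T"
proof
  let ?X = "drift_process \<alpha> \<beta> w"
  assume "slope_process \<alpha> \<beta> w 0 \<le> a"
  show "0 \<le> T"
  proof (rule ccontr)
    assume T: "\<not> 0 \<le> T"
    then obtain b s where "\<And>u. b + s * u \<le> ?X u" "?X T < b + a * T"
      using separating_line[OF X q _ min] by force
    then have "a < slope_process \<alpha> \<beta> w 0"
      unfolding slope_process_eq using T
      by (intro left_deriv_gcm_greater[OF two_sided_unbounded_UNIV, of b s _ T]) auto
    then show False using \<open>slope_process \<alpha> \<beta> w 0 \<le> a\<close> by simp
  qed
next
  let ?X = "drift_process \<alpha> \<beta> w"
  assume T: "0 \<le> T"
  have "(?X T - a * T) + a * u \<le> ?X u" for u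
    using min[of u] by (cases "u = T") auto
  then show "slope_process \<alpha> \<beta> w 0 \<le> a"
    unfolding slope_process_eq using T
    by (intro left_deriv_gcm_le[OF two_sided_unbounded_UNIV, of "?X T - a * T" _ _ T]) auto
qed

text \<open>
  A line below the path that lies strictly above the chord of slope \<open>a\<close> through \<open>(T, X T)\<close> at the
  origin survives the discretisation: \<open>T\<close> is approximated by grid points, and the perturbation
  \<open>\<beta> c t\<close> is linear, so it is absorbed by the slope of the line.
\<close>

lemma eventually_grid_slope_zero_le_iff:
  assumes X: "continuous_on UNIV (drift_process \<alpha> \<beta> w)"
    and q: "quadratic_lower_bound (drift_process \<alpha> \<beta> w)"
    and min: "\<And>u. u \<noteq> T \<Longrightarrow>
      drift_process \<alpha> \<beta> w T - a * T < drift_process \<alpha> \<beta> w u - a * u"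
    and T: "T \<noteq> 0" and c: "\<And>n. 0 < c n" "c \<longlonglongrightarrow> 0"
  shows "\<forall>\<^sub>F n in sequentially. grid_slope_zero (c n) \<alpha> \<beta> w \<le> a \<longleftrightarrow> 0 \<le> T"
proof -
  let ?X = "drift_process \<alpha> \<beta> w"
  let ?D = "\<lambda>n. range (\<lambda>k::int. c n * of_int k)"
  obtain b s where line: "\<And>u. b + s * u \<le> ?X u" and T_line: "?X T < b + a * T"
    using separating_line[OF X q T min] by blast
  \<comment> \<open>The last grid point not to the right of \<open>T\<close>, at distance less than
    \<open>c n\<close>.\<close>
  define t where "t n = c n * of_int \<lfloor>T / c n\<rfloor>" for n
  have t_grid: "t n \<in> ?D n" for n by (auto simp: t_def)
  have lim_t: "t \<longlonglongrightarrow> T"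
  proof (rule tendsto_sandwich[OF always_eventually always_eventually])
    have fl: "of_int \<lfloor>T / c n\<rfloor> \<le> T / c n" "T / c n - 1 \<le> of_int \<lfloor>T / c n\<rfloor>" for n
      by linarith+
    have cT: "c n * (T / c n) = T" "c n * (T / c n - 1) = T - c n" for n
      using c(1)[of n] by (auto simp: right_diff_distrib)
    have "t n \<le> c n * (T / c n)" "c n * (T / c n - 1) \<le> t n" for n
      unfolding t_def by (rule mult_left_mono[OF fl(1) less_imp_le[OF c(1)]]
          mult_left_mono[OF fl(2) less_imp_le[OF c(1)]])+
    then show "\<forall>n. t n \<le> T" "\<forall>n. T - c n \<le> t n"
      unfolding cT by blast+
    show "(\<lambda>n. T - c n) \<longlonglongrightarrow> T" using tendsto_diff[OF tendsto_const c(2), of T] by simp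
  qed simp
  have "isCont ?X T" using X by (simp add: continuous_on_eq_continuous_at)
  then have "(\<lambda>n. ?X (t n)) \<longlonglongrightarrow> ?X T" by (rule isCont_tendsto_compose) (rule lim_t)
  then have "(\<lambda>n. ?X (t n) + \<beta> * c n * t n) \<longlonglongrightarrow> ?X T + \<beta> * 0 * T"
    by (intro tendsto_intros c lim_t)
  moreover have "(\<lambda>n. b + a * t n) \<longlonglongrightarrow> b + a * T" by (intro tendsto_intros lim_t)
  ultimately have "(\<lambda>n. b + a * t n - (?X (t n) + \<beta> * c n * t n))
      \<longlonglongrightarrow> b + a * T - (?X T + \<beta> * 0 * T)"
    by (intro tendsto_diff)
  then have "\<forall>\<^sub>F n in sequentially. 0 < b + a * t n - (?X (t n) + \<beta> * c n * t n)"
    using T_line by (intro order_tendstoD(1)) auto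
  then have ev: "\<forall>\<^sub>F n in sequentially. ?X (t n) + \<beta> * c n * t n < b + a * t n"
    by eventually_elim simp
  have line': "b + (s + \<beta> * c n) * u \<le> ?X u + \<beta> * c n * u" for n u
    using line[of u] by (simp add: algebra_simps)
  show ?thesis
  proof (cases "T < 0")
    case True
    with lim_t have "\<forall>\<^sub>F n in sequentially. t n < 0" by (intro order_tendstoD(2))
    with ev show ?thesis
    proof eventually_elim
      case (elim n)
      have "a < grid_slope_zero (c n) \<alpha> \<beta> w"
        unfolding grid_slope_zero_eq
        by (rule left_deriv_gcm_greater[OF two_sided_unbounded_grid[OF c(1)] line' t_grid elim(2,1)])
      then show ?case using True by simp
    qed
  next
    case False
    then have "0 < T" using T by simp
    with lim_t have "\<forall>\<^sub>F n in sequentially. 0 < t n" by (intro order_tendstoD(1))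
    with ev show ?thesis
    proof eventually_elim
      case (elim n)
      have "grid_slope_zero (c n) \<alpha> \<beta> w < a"
        unfolding grid_slope_zero_eq
        by (rule left_deriv_gcm_less[OF two_sided_unbounded_grid[OF c(1)] line' t_grid elim(2,1)])
      then show ?case using False by simp
    qed
  qed
qed

section \<open>Brownian scaling and the limit theorem\<close>

context two_sided_brownian_motion
begin

lemma continuous_drift_process:
  "\<omega> \<in> space M \<Longrightarrow> continuous_on UNIV (drift_process \<alpha> \<beta> (\<lambda>t. W t \<omega>))"
  unfolding drift_process_def by (intro continuous_intros continuous_paths)

lemma grid_slope_zero_measurable:
  assumes "0 < c"
  shows "(\<lambda>\<omega>. grid_slope_zero c \<alpha> \<beta> (\<lambda>t. W t \<omega>)) \<in> borel_measurable M"
proof -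
  note [measurable] = measurable_W
  show ?thesis
    unfolding grid_slope_zero_eq drift_process_def
    by (intro borel_measurable_left_deriv_gcm two_sided_unbounded_grid assms) measurable
qed

text \<open>For continuous paths the minorant over the whole line is the one over
  \<open>\<rat>\<close>, which reduces the claim to a countable set of abscissae.\<close>

lemma slope_process_measurable:
  "(\<lambda>\<omega>. slope_process \<alpha> \<beta> (\<lambda>t. W t \<omega>) h) \<in> borel_measurable M"
proof -
  note [measurable] = measurable_W
  have "(\<lambda>\<omega>. left_deriv (gcm (graph_on \<rat> (drift_process \<alpha> \<beta> (\<lambda>t. W t \<omega>)))) h)
      \<in> borel_measurable M"
    unfolding drift_process_def
    by (intro borel_measurable_left_deriv_gcm two_sided_unbounded_Rats countable_rat) measurable
  then show ?thesis
    by (rule measurable_cong[THEN iffD1, rotated])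
      (simp add: slope_process_eq gcm_graph_on_Rats[OF continuous_drift_process])
qed

text \<open>
  With \<open>\<mu>\<^sup>3 = \<alpha>/\<beta>\<close> and \<open>h = a/(2\<beta>)\<close>, substituting \<open>t = h - \<mu>\<^sup>2 s\<close> and completing the square turns
  \<open>\<alpha> W t + \<beta> t\<^sup>2 - a t\<close> into \<open>\<beta> \<mu>\<^sup>4 (V s + s\<^sup>2)\<close> up to an additive constant, where \<open>V\<close> is again
  a Brownian motion.
\<close>

lemma AE_slope_events:
  assumes \<beta>: "0 < \<beta>" and \<mu>: "0 < \<mu>" and \<alpha>: "\<alpha> = \<beta> * \<mu> ^ 3"
  obtains V where "two_sided_brownian_motion M V"
    and "AE \<omega> in M. slope_process \<alpha> \<beta> (\<lambda>t. W t \<omega>) 0 \<le> a \<longleftrightarrow>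
      2 * \<beta> * \<mu>\<^sup>2 * chernoff_minimizer (\<lambda>t. V t \<omega>) \<le> a"
    and "\<And>c. (\<And>n. 0 < c n) \<Longrightarrow> c \<longlonglongrightarrow> 0 \<Longrightarrow>
      AE \<omega> in M. 2 * \<beta> * \<mu>\<^sup>2 * chernoff_minimizer (\<lambda>t. V t \<omega>) \<noteq> a \<longrightarrow>
        (\<forall>\<^sub>F n in sequentially. grid_slope_zero (c n) \<alpha> \<beta> (\<lambda>t. W t \<omega>) \<le> a \<longleftrightarrow>
          slope_process \<alpha> \<beta> (\<lambda>t. W t \<omega>) 0 \<le> a)"
proof -
  define h where "h = a / (2 * \<beta>)"
  define V where "V s \<omega> = (W (h - \<mu>\<^sup>2 * s) \<omega> - W h \<omega>) / sqrt (\<mu>\<^sup>2)" for s \<omega>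
  have V: "two_sided_brownian_motion M V"
    unfolding V_def using \<mu> by (intro reversed_brownian_motion) simp
  interpret V: two_sided_brownian_motion M V by (rule V)
  define X where "X \<omega> = drift_process \<alpha> \<beta> (\<lambda>t. W t \<omega>)" for \<omega>
  \<comment> \<open>The candidate minimizer of \<open>X \<omega> t - a * t\<close>. Thanks to the
    reflection, \<open>0 \<le> T \<omega>\<close> is an upper bound on the Chernoff minimizer, the
    form in which distribution functions are compared.\<close>
  define T where "T \<omega> = h - \<mu>\<^sup>2 * chernoff_minimizer (\<lambda>t. V t \<omega>)" for \<omega>
  have scale: "X \<omega> (h - \<mu>\<^sup>2 * s) - a * (h - \<mu>\<^sup>2 * s)
      = \<beta> * \<mu> ^ 4 * (V s \<omega> + s\<^sup>2) + (\<alpha> * W h \<omega> - \<beta> * h\<^sup>2)" for s \<omega>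
  proof -
    have "\<beta> * \<mu> ^ 4 * V s \<omega> = \<alpha> * (W (h - \<mu>\<^sup>2 * s) \<omega> - W h \<omega>)"
      using \<mu> by (simp add: V_def \<alpha> power4_eq_xxxx power3_eq_cube)
    moreover have "\<beta> * (h - \<mu>\<^sup>2 * s)\<^sup>2 - a * (h - \<mu>\<^sup>2 * s) = \<beta> * \<mu> ^ 4 * s\<^sup>2 - \<beta> * h\<^sup>2"
    proof -
      have a: "a = 2 * \<beta> * h" using \<beta> by (simp add: h_def)
      show ?thesis unfolding a by (simp add: power4_eq_xxxx power2_eq_square algebra_simps)
    qed
    ultimately show ?thesis by (simp add: X_def drift_process_def algebra_simps)
  qed
  have pos: "0 < \<beta> * \<mu> ^ 4" "0 < \<mu>\<^sup>2" using \<beta> \<mu> by simp_all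
  have min: "AE \<omega> in M. \<forall>u. u \<noteq> T \<omega> \<longrightarrow> X \<omega> (T \<omega>) - a * T \<omega> < X \<omega> u - a * u"
    using V.AE_unique_chernoff_minimizer
  proof eventually_elim
    case (elim \<omega>)
    let ?Y = "\<lambda>t. X \<omega> t - a * t"
    let ?Z = "chernoff_minimizer (\<lambda>t. V t \<omega>)"
    have iff: "(\<forall>u. ?Y (h - \<mu>\<^sup>2 * s) \<le> ?Y u) \<longleftrightarrow> is_chernoff_minimizer (\<lambda>t. V t \<omega>) s" for s
      using minimizer_affine_iff[where Y = ?Y and V = "\<lambda>s. V s \<omega> + s\<^sup>2", OF scale pos]
      by (simp add: is_chernoff_minimizer_def is_arg_min_linorder)
    have Z: "is_chernoff_minimizer (\<lambda>t. V t \<omega>) ?Z"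
      unfolding chernoff_minimizer_def if_P[OF elim] by (rule theI'[OF elim])
    have uniq: "u = T \<omega>" if "\<forall>v. ?Y u \<le> ?Y v" for u
    proof -
      have u: "h - \<mu>\<^sup>2 * ((h - u) / \<mu>\<^sup>2) = u" using \<mu> by simp
      have "is_chernoff_minimizer (\<lambda>t. V t \<omega>) ((h - u) / \<mu>\<^sup>2)"
        using that unfolding iff[symmetric] u .
      then have "(h - u) / \<mu>\<^sup>2 = ?Z" using elim Z by blast
      then show ?thesis using u by (simp add: T_def)
    qed
    have T: "\<forall>v. ?Y (T \<omega>) \<le> ?Y v" unfolding T_def iff by (rule Z)
    show ?case
    proof (intro allI impI)
      fix u assume "u \<noteq> T \<omega>"
      then obtain v where "?Y v < ?Y u" using uniq[of u] by (metis not_le)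
      then show "?Y (T \<omega>) < ?Y u" using T by (metis order_le_less_trans)
    qed
  qed
  have bound: "AE \<omega> in M. quadratic_lower_bound (X \<omega>)"
    using V.AE_quadratic_lower_bound
  proof eventually_elim
    case (elim \<omega>)
    have "quadratic_lower_bound (\<lambda>t. X \<omega> t - a * t)"
      by (rule quadratic_lower_bound_affine[OF scale pos elim])
    from quadratic_lower_bound_diff_linear[OF this, of "- a"] show ?case by simp
  qed
  have T_sign: "0 \<le> T \<omega> \<longleftrightarrow> 2 * \<beta> * \<mu>\<^sup>2 * chernoff_minimizer (\<lambda>t. V t \<omega>) \<le> a"
    "T \<omega> = 0 \<longleftrightarrow> 2 * \<beta> * \<mu>\<^sup>2 * chernoff_minimizer (\<lambda>t. V t \<omega>) = a" for \<omega>
    using \<beta> by (auto simp: T_def h_def field_simps)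
  show thesis
  proof (rule that[OF V])
    show "AE \<omega> in M. slope_process \<alpha> \<beta> (\<lambda>t. W t \<omega>) 0 \<le> a \<longleftrightarrow>
        2 * \<beta> * \<mu>\<^sup>2 * chernoff_minimizer (\<lambda>t. V t \<omega>) \<le> a"
      using min bound AE_space
    proof eventually_elim
      case (elim \<omega>)
      show ?case
        unfolding T_sign(1)[symmetric]
        by (rule slope_process_le_iff) (use elim continuous_drift_process in \<open>auto simp: X_def\<close>)
    qed
  next
    fix c :: "nat \<Rightarrow> real" assume c: "\<And>n. 0 < c n" "c \<longlonglongrightarrow> 0"
    show "AE \<omega> in M. 2 * \<beta> * \<mu>\<^sup>2 * chernoff_minimizer (\<lambda>t. V t \<omega>) \<noteq> a \<longrightarrow>
        (\<forall>\<^sub>F n in sequentially. grid_slope_zero (c n) \<alpha> \<beta> (\<lambda>t. W t \<omega>) \<le> a \<longleftrightarrow>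
          slope_process \<alpha> \<beta> (\<lambda>t. W t \<omega>) 0 \<le> a)"
      using min bound AE_space
    proof eventually_elim
      case (elim \<omega>)
      have X: "continuous_on UNIV (drift_process \<alpha> \<beta> (\<lambda>t. W t \<omega>))"
        by (rule continuous_drift_process[OF elim(3)])
      have q: "quadratic_lower_bound (drift_process \<alpha> \<beta> (\<lambda>t. W t \<omega>))"
        using elim(2) by (simp add: X_def)
      have min: "drift_process \<alpha> \<beta> (\<lambda>t. W t \<omega>) (T \<omega>) - a * T \<omega>
          < drift_process \<alpha> \<beta> (\<lambda>t. W t \<omega>) u - a * u" if "u \<noteq> T \<omega>" for u
        using elim(1) that by (simp add: X_def)
      have "slope_process \<alpha> \<beta> (\<lambda>t. W t \<omega>) 0 \<le> a \<longleftrightarrow> 0 \<le> T \<omega>"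
        by (rule slope_process_le_iff[OF X q]) (rule min)
      moreover have "\<forall>\<^sub>F n in sequentially. grid_slope_zero (c n) \<alpha> \<beta> (\<lambda>t. W t \<omega>) \<le> a \<longleftrightarrow> 0 \<le> T \<omega>"
        if "T \<omega> \<noteq> 0"
        by (rule eventually_grid_slope_zero_le_iff[OF X q _ that c]) (rule min)
      ultimately show ?case unfolding T_sign(2)[symmetric] by simp
    qed
  qed
qed

text \<open>The motion \<open>V\<close> from \<open>AE_slope_events\<close> changes with
  \<open>a\<close>, so the two sides are compared at each \<open>a\<close> separately; the law of
  its Chernoff minimizer is the same for every such \<open>V\<close>.\<close>

lemma distr_slope_process:
  assumes \<beta>: "0 < \<beta>" and \<mu>: "0 < \<mu>" and \<alpha>: "\<alpha> = \<beta> * \<mu> ^ 3"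
    and B: "two_sided_brownian_motion N B"
  shows "distr M borel (\<lambda>\<omega>. slope_process \<alpha> \<beta> (\<lambda>t. W t \<omega>) 0)
    = distr N borel (\<lambda>\<omega>. 2 * \<beta> * \<mu>\<^sup>2 * chernoff_minimizer (\<lambda>t. B t \<omega>))"
proof (rule cdf_unique)
  interpret B: two_sided_brownian_motion N B by (rule B)
  note [measurable] = slope_process_measurable B.chernoff_minimizer_measurable
  show "real_distribution (distr M borel (\<lambda>\<omega>. slope_process \<alpha> \<beta> (\<lambda>t. W t \<omega>) 0))"
    by (rule real_distribution_distr) measurable
  show "real_distribution (distr N borel (\<lambda>\<omega>. 2 * \<beta> * \<mu>\<^sup>2 * chernoff_minimizer (\<lambda>t. B t \<omega>)))"
    by (rule B.real_distribution_distr) measurable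
  show "cdf (distr M borel (\<lambda>\<omega>. slope_process \<alpha> \<beta> (\<lambda>t. W t \<omega>) 0))
    = cdf (distr N borel (\<lambda>\<omega>. 2 * \<beta> * \<mu>\<^sup>2 * chernoff_minimizer (\<lambda>t. B t \<omega>)))"
  proof
    fix a
    obtain V where V: "two_sided_brownian_motion M V"
      and AE: "AE \<omega> in M. slope_process \<alpha> \<beta> (\<lambda>t. W t \<omega>) 0 \<le> a \<longleftrightarrow>
        2 * \<beta> * \<mu>\<^sup>2 * chernoff_minimizer (\<lambda>t. V t \<omega>) \<le> a"
      by (rule AE_slope_events[OF \<beta> \<mu> \<alpha>])
    interpret V: two_sided_brownian_motion M V by (rule V)
    note [measurable] = V.chernoff_minimizer_measurable
    let ?A = "{z. 2 * \<beta> * \<mu>\<^sup>2 * z \<le> a}"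
    have A: "?A \<in> sets borel" by measurable
    have "cdf (distr M borel (\<lambda>\<omega>. slope_process \<alpha> \<beta> (\<lambda>t. W t \<omega>) 0)) a
        = prob {\<omega> \<in> space M. slope_process \<alpha> \<beta> (\<lambda>t. W t \<omega>) 0 \<le> a}"
      by (auto simp: cdf_def measure_distr intro!: arg_cong[where f = prob])
    also have "\<dots> = prob {\<omega> \<in> space M. 2 * \<beta> * \<mu>\<^sup>2 * chernoff_minimizer (\<lambda>t. V t \<omega>) \<le> a}"
      by (rule finite_measure_eq_AE) (use AE in auto)
    also have "\<dots> = measure (distr M borel (\<lambda>\<omega>. chernoff_minimizer (\<lambda>t. V t \<omega>))) ?A"
      using A by (auto simp: measure_distr intro!: arg_cong[where f = prob])
    also have "\<dots> = measure (distr N borel (\<lambda>\<omega>. chernoff_minimizer (\<lambda>t. B t \<omega>))) ?A"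
      by (simp only: chernoff_minimizer_law_unique[OF V B])
    also have "\<dots> = cdf (distr N borel (\<lambda>\<omega>. 2 * \<beta> * \<mu>\<^sup>2 * chernoff_minimizer (\<lambda>t. B t \<omega>))) a"
      using A by (auto simp: cdf_def measure_distr intro!: arg_cong[where f = "measure N"])
    finally show "cdf (distr M borel (\<lambda>\<omega>. slope_process \<alpha> \<beta> (\<lambda>t. W t \<omega>) 0)) a
        = cdf (distr N borel (\<lambda>\<omega>. 2 * \<beta> * \<mu>\<^sup>2 * chernoff_minimizer (\<lambda>t. B t \<omega>))) a" .
  qed
qed

lemma weak_conv_grid_slope_zero:
  assumes \<beta>: "0 < \<beta>" and \<mu>: "0 < \<mu>" and \<alpha>: "\<alpha> = \<beta> * \<mu> ^ 3"
    and c: "\<And>n. 0 < c n" "c \<longlonglongrightarrow> 0"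
  shows "weak_conv_m (\<lambda>n. distr M borel (\<lambda>\<omega>. grid_slope_zero (c n) \<alpha> \<beta> (\<lambda>t. W t \<omega>)))
    (distr M borel (\<lambda>\<omega>. slope_process \<alpha> \<beta> (\<lambda>t. W t \<omega>) 0))"
  unfolding weak_conv_m_def weak_conv_def
proof (intro allI impI)
  let ?G = "\<lambda>\<omega>. slope_process \<alpha> \<beta> (\<lambda>t. W t \<omega>) 0"
  let ?S = "\<lambda>n \<omega>. grid_slope_zero (c n) \<alpha> \<beta> (\<lambda>t. W t \<omega>)"
  note [measurable] = slope_process_measurable grid_slope_zero_measurable[OF c(1)]
  interpret G: real_distribution "distr M borel ?G"
    by (rule real_distribution_distr) measurable
  fix a assume "isCont (cdf (distr M borel ?G)) a"
  then have null: "measure (distr M borel ?G) {a} = 0" by (simp add: G.isCont_cdf)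
  obtain V where V: "two_sided_brownian_motion M V"
    and AE: "AE \<omega> in M. 2 * \<beta> * \<mu>\<^sup>2 * chernoff_minimizer (\<lambda>t. V t \<omega>) \<noteq> a \<longrightarrow>
        (\<forall>\<^sub>F n in sequentially. ?S n \<omega> \<le> a \<longleftrightarrow> ?G \<omega> \<le> a)"
    by (rule AE_slope_events[OF \<beta> \<mu> \<alpha>, of a]) (use c in blast)
  interpret V: two_sided_brownian_motion M V by (rule V)
  note [measurable] = V.chernoff_minimizer_measurable
  \<comment> \<open>Taking \<open>V\<close> itself as the reference motion in
    \<open>distr_slope_process\<close> turns continuity at \<open>a\<close> into nullity of the
    exceptional event for exactly this \<open>V\<close>.\<close>
  have "prob {\<omega> \<in> space M. 2 * \<beta> * \<mu>\<^sup>2 * chernoff_minimizer (\<lambda>t. V t \<omega>) = a} = 0"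
    using null unfolding distr_slope_process[OF \<beta> \<mu> \<alpha> V]
    by (simp add: measure_distr vimage_def Int_def conj_commute)
  then have "AE \<omega> in M. 2 * \<beta> * \<mu>\<^sup>2 * chernoff_minimizer (\<lambda>t. V t \<omega>) \<noteq> a"
    by (subst (asm) prob_eq_0) (auto elim: AE_mp)
  with AE have ev: "AE \<omega> in M. \<forall>\<^sub>F n in sequentially. ?S n \<omega> \<le> a \<longleftrightarrow> ?G \<omega> \<le> a"
    by eventually_elim blast
  have cdf_eq: "cdf (distr M borel X) a = (\<integral>\<omega>. indicator {..a} (X \<omega>) \<partial>M)"
    if [measurable]: "X \<in> borel_measurable M" for X :: "'a \<Rightarrow> real"
  proof -
    have "cdf (distr M borel X) a = prob (X -` {..a} \<inter> space M)"
      by (simp add: cdf_def measure_distr)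
    also have "\<dots> = (\<integral>\<omega>. indicator (X -` {..a} \<inter> space M) \<omega> \<partial>M)" by simp
    also have "\<dots> = (\<integral>\<omega>. indicator {..a} (X \<omega>) \<partial>M)"
      by (intro Bochner_Integration.integral_cong) (auto simp: indicator_def)
    finally show ?thesis .
  qed
  have "(\<lambda>n. \<integral>\<omega>. indicator {..a} (?S n \<omega>) \<partial>M) \<longlonglongrightarrow> (\<integral>\<omega>. indicator {..a} (?G \<omega>) \<partial>M :: real)"
  proof (rule integral_dominated_convergence[where w = "\<lambda>_. 1"])
    show "AE \<omega> in M. (\<lambda>n. indicator {..a} (?S n \<omega>)) \<longlonglongrightarrow> (indicator {..a} (?G \<omega>) :: real)"
      using ev
    proof eventually_elim
      case (elim \<omega>)
      then have "\<forall>\<^sub>F n in sequentially. indicator {..a} (?S n \<omega>) = (indicator {..a} (?G \<omega>) :: real)"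
        by eventually_elim (simp add: indicator_def)
      then show ?case by (rule tendsto_eventually)
    qed
  qed (auto simp: indicator_def)
  then show "(\<lambda>n. cdf (distr M borel (?S n)) a) \<longlonglongrightarrow> cdf (distr M borel ?G) a"
    by (simp add: cdf_eq)
qed

end

theorem theorem4p2:
  fixes F f g :: "real \<Rightarrow> real" and x\<^sub>0 \<alpha> \<beta> :: real
    and M :: "'a measure" and W :: "real \<Rightarrow> 'a \<Rightarrow> real"
    and N :: "'b measure" and B :: "real \<Rightarrow> 'b \<Rightarrow> real"
    and S :: "real \<Rightarrow> 'a \<Rightarrow> real" and G :: "'a \<Rightarrow> real" and Z :: "'b \<Rightarrow> real"
  assumes f: "density_fun f" and F: "F = cdf (density lborel f)"
    and g: "density_fun g"
    and F_x0: "0 < F x\<^sub>0" "F x\<^sub>0 < 1" and f_x0: "0 < f x\<^sub>0" and g_x0: "0 < g x\<^sub>0"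
    and W: "two_sided_brownian_motion M W"
    and B: "two_sided_brownian_motion N B"
  defines "\<alpha> \<equiv> sqrt (F x\<^sub>0 * (1 - F x\<^sub>0) / g x\<^sub>0)"
    and "\<beta> \<equiv> f x\<^sub>0 / 2"
    and "S \<equiv> \<lambda>c \<omega>. grid_slope_zero c \<alpha> \<beta> (\<lambda>t. W t \<omega>)"
    and "G \<equiv> \<lambda>\<omega>. slope_process \<alpha> \<beta> (\<lambda>t. W t \<omega>) 0"
    and "Z \<equiv> \<lambda>\<omega>. chernoff_minimizer (\<lambda>t. B t \<omega>)"
  shows "(\<forall>c>0. S c \<in> borel_measurable M) \<and> G \<in> borel_measurable M \<and>
    (\<forall>c :: nat \<Rightarrow> real. (\<forall>n. 0 < c n) \<longrightarrow> c \<longlonglongrightarrow> 0 \<longrightarrow>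
      weak_conv_m (\<lambda>n. distr M borel (S (c n))) (distr M borel G)) \<and>
    Z \<in> borel_measurable N \<and>
    (AE \<omega> in N. \<exists>!t. is_chernoff_minimizer (\<lambda>s. B s \<omega>) t) \<and>
    distr M borel G = distr N borel (\<lambda>\<omega>. 2 * (\<alpha>\<^sup>2 * \<beta>) powr (1 / 3) * Z \<omega>)"
proof -
  interpret W: two_sided_brownian_motion M W by (rule W)
  interpret B: two_sided_brownian_motion N B by (rule B)
  have \<alpha>: "0 < \<alpha>" and \<beta>: "0 < \<beta>"
    using F_x0 f_x0 g_x0 by (simp_all add: \<alpha>_def \<beta>_def)
  \<comment> \<open>Under \<open>t = \<mu>\<^sup>2 * s\<close> the noise scales by
    \<open>\<alpha> * \<mu>\<close> and the parabola by \<open>\<beta> * \<mu> ^ 4\<close>; equating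
    the two factors gives \<open>\<mu>\<close>.\<close>
  define \<mu> where "\<mu> = root 3 (\<alpha> / \<beta>)"
  have \<mu>: "0 < \<mu>" using \<alpha> \<beta> by (simp add: \<mu>_def)
  have "\<mu> ^ 3 = \<alpha> / \<beta>" using \<alpha> \<beta> by (simp add: \<mu>_def)
  then have \<alpha>_eq: "\<alpha> = \<beta> * \<mu> ^ 3" using \<beta> by simp
  have "\<alpha>\<^sup>2 * \<beta> = (\<beta> * \<mu>\<^sup>2) ^ 3"
    by (simp add: \<alpha>_eq power_mult_distrib power2_eq_square power3_eq_cube)
  then have "(\<alpha>\<^sup>2 * \<beta>) powr (1 / 3) = \<beta> * \<mu>\<^sup>2"
    using \<beta> \<mu> by (simp add: powr_powr flip: powr_numeral)
  then have "distr M borel G = distr N borel (\<lambda>\<omega>. 2 * (\<alpha>\<^sup>2 * \<beta>) powr (1 / 3) * Z \<omega>)"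
    using W.distr_slope_process[OF \<beta> \<mu> \<alpha>_eq B] by (simp add: G_def Z_def mult.assoc)
  moreover have "weak_conv_m (\<lambda>n. distr M borel (S (c n))) (distr M borel G)"
    if "\<forall>n. 0 < c n" "c \<longlonglongrightarrow> 0" for c :: "nat \<Rightarrow> real"
    unfolding S_def G_def using that
    by (intro W.weak_conv_grid_slope_zero[OF \<beta> \<mu> \<alpha>_eq]) auto
  ultimately show ?thesis
    using W.grid_slope_zero_measurable W.slope_process_measurable B.chernoff_minimizer_measurable
      B.AE_unique_chernoff_minimizer
    by (auto simp: S_def G_def Z_def)
qed

end
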